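(* Let $G\leq \mathrm{Aut}(X^* )$ be a finitely generated regular branch group that is just infinite, is strongly self-replicating, has well-approximated subgroups, and obeys the Grigorchuk--Nagnibeda alternative. Then for $H\leq G$, $H$ lies in the perfect kernel of $\mathrm{Sub}(G)$ if and only if either (1) $\psi_y(H)$ is finite for some $y\in X^*$, or (2) $H$ is not finitely generated.
   Context: Let $X$ be a finite set and $X^*$ the free monoid on $X$, identified with the rooted tree in which the children of $w$ are the words $wx$, $x\in X$. $|x|$ denotes word length, $X^n$ the words of length $n$ (level $n$), and $x\sqsubseteq y$ means $x$ is a prefix of $y$. $\mathrm{Aut}(X^* )$ is the group of bijections of $X^*$ preserving the prefix relation. For $g\in\mathrm{Aut}(X^* )$ and $u\in X^*$ the section $g_u\in\mathrm{Aut}(X^* )$ is defined by $g(uw)=g(u)g_u(w)$ for all $w$; $\psi_u(g):=g_u$ and for a set $S$ of automorphisms $\psi_u(S)=\{g_u:g\in S\}$. For $G\leq \mathrm{Aut}(X^* )$: $\mathrm{st}_G(x)$ is the stabilizer of the vertex $x$, $\mathrm{st}_G(Y)=\bigcap_{y\in Y}\mathrm{st}_G(y)$, $\mathrm{st}_G(n)=\mathrm{st}_G(X^n)$; $\mathrm{rist}_G(x)$ is the set of elements fixing every vertex not having $x$ as a prefix, and $\mathrm{rist}_G(n)$ is the subgroup generated by $\mathrm{rist}_G(x)$, $x\in X^n$. A leaf set is a finite $Y\subseteq X^*$ no element of which is a prefix of another; it is spanning if there is $N$ such that every $x$ with $|x|\ge N$ has a prefix in $Y$. For a leaf set $Y$,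 $G^Y$ is the group of automorphisms acting as an element of $G$ on the subtree below each $y\in Y$ (fixing each $y$, with section at $y$ in $G$) and trivially elsewhere; $G^Y\cong G^{|Y|}$ via $\psi_Y=(\psi_y)_{y\in Y}$. For $H\le G$ and a spanning leaf set $Y$, $\mathrm{st}_H(Y)$ is called an infra-direct product of $G^Y$ if for every $y\in Y$, $\psi_y(\mathrm{st}_H(Y))$ is a finite index subgroup of $G$. $G$ is self-similar if $g_x\in G$ for all $g\in G$, $x\in X^*$; strongly self-replicating if self-similar and $\psi_x(\mathrm{st}_G(n))=G$ for all $n\ge1$ and $x\in X^n$. $G$ is regular branch if it is self-similar, acts transitively on every level, and has a finite index normal subgroup $K$ (branching subgroup) such that $K^{\{x\}}\le K$ for all $x\in X^*$ and $K^{X^n}$ has finite index in $G$ for all $n$. $G$ is just infinite if infinite with all proper quotients finite. $G$ has well-approximated subgroups if $\bigcap_{n\ge0}H\,\mathrm{st}_G(n)=H$ for every finitely generated $H\le G$. $G$ obeys the Grigorchuk--Nagnibeda alternative if for every finitely generated $H\le G$, either there is $y\in X^*$ with $\psi_y(H)$ finite, or there is a spanning leaf set $Y$ such that $\mathrm{st}_H(Y)$ is an infra-direct product of $G^Y$. $\mathrm{Sub}(G)$ is the set of subgroups of $G$ with the topology induced from $\{0,1\}^G$ (Chabauty topology). With Cantor--Bendixson derivatives $Z^0=Z$, $Z^{\alpha+1}=$ non-isolated points of $Z^\alpha$, $Z^\lambda=\bigcap_{\alpha<\lambda}Z^\alpha$, the perfect kernel of $Z$ is $Z^\alpha$ for the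 least $\alpha$ with $Z^\alpha=Z^{\alpha+1}$. *)

theory Defs
  imports "HOL-Analysis.Analysis" "HOL-Algebra.Algebra" "HOL-Library.Sublist"
begin

(* The alphabet X is the (finite) type 'a; X^* is 'a list; prefix = Sublist.prefix. *)

type_synonym 'a aut = "'a list \<Rightarrow> 'a list"

definition is_tree_aut :: "'a aut \<Rightarrow> bool" where
  "is_tree_aut g \<longleftrightarrow> bij g \<and> (\<forall>u v. prefix u v \<longleftrightarrow> prefix (g u) (g v))"

definition Aut_grp :: "('a::finite) aut monoid" where
  "Aut_grp = \<lparr>carrier = {g. is_tree_aut g}, mult = (\<circ>), one = id\<rparr>"

definition grp :: "('a::finite) aut set \<Rightarrow> 'a aut monoid" where
  "grp G = Aut_grp\<lparr>carrier := G\<rparr>"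

(* section g_u: g(uw) = g(u) g_u(w) *)
definition sect :: "'a aut \<Rightarrow> 'a list \<Rightarrow> 'a aut" where
  "sect g u = (\<lambda>w. drop (length (g u)) (g (u @ w)))"

definition psi :: "'a list \<Rightarrow> 'a aut set \<Rightarrow> 'a aut set" where
  "psi u S = (\<lambda>g. sect g u) ` S"

definition level :: "nat \<Rightarrow> 'a list set" where
  "level n = {x. length x = n}"

definition stab_set :: "'a aut set \<Rightarrow> 'a list set \<Rightarrow> 'a aut set" where
  "stab_set G Y = {g \<in> G. \<forall>y\<in>Y. g y = y}"

definition stab_level :: "'a aut set \<Rightarrow> nat \<Rightarrow> 'a aut set" where
  "stab_level G n = stab_set G (level n)"

definition leaf_set :: "'a list set \<Rightarrow> bool" where
  "leaf_set Y \<longleftrightarrow> finite Y \<and> (\<forall>a\<in>Y. \<forall>b\<in>Y. prefix a b \<longrightarrow> a = b)"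

definition spanning :: "'a list set \<Rightarrow> bool" where
  "spanning Y \<longleftrightarrow> (\<exists>N. \<forall>x. length x \<ge> N \<longrightarrow> (\<exists>y\<in>Y. prefix y x))"

definition aut_pow :: "('a::finite) aut set \<Rightarrow> 'a list set \<Rightarrow> 'a aut set" where
  "aut_pow G Y = {g. is_tree_aut g \<and> (\<forall>y\<in>Y. g y = y \<and> sect g y \<in> G)
                     \<and> (\<forall>v. (\<forall>y\<in>Y. \<not> prefix y v) \<longrightarrow> g v = v)}"

definition fin_index :: "('a::finite) aut set \<Rightarrow> 'a aut set \<Rightarrow> bool" where
  "fin_index H G \<longleftrightarrow> subgroup H (grp G) \<and> finite (rcosets\<^bsub>grp G\<^esub> H)"

definition self_similar :: "('a::finite) aut set \<Rightarrow> bool" where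
  "self_similar G \<longleftrightarrow> (\<forall>g\<in>G. \<forall>x. sect g x \<in> G)"

definition strongly_self_replicating :: "('a::finite) aut set \<Rightarrow> bool" where
  "strongly_self_replicating G \<longleftrightarrow> self_similar G \<and>
     (\<forall>n\<ge>1. \<forall>x\<in>level n. psi x (stab_level G n) = G)"

definition level_transitive :: "('a::finite) aut set \<Rightarrow> bool" where
  "level_transitive G \<longleftrightarrow> (\<forall>n. \<forall>u\<in>level n. \<forall>v\<in>level n. \<exists>g\<in>G. g u = v)"

definition regular_branch :: "('a::finite) aut set \<Rightarrow> bool" where
  "regular_branch G \<longleftrightarrow> self_similar G \<and> level_transitive G \<and>
     (\<exists>K. normal K (grp G) \<and> fin_index K G \<and>
          (\<forall>x. aut_pow K {x} \<subseteq> K) \<and> (\<forall>n. fin_index (aut_pow K (level n)) G))"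

definition just_infinite :: "('a::finite) aut set \<Rightarrow> bool" where
  "just_infinite G \<longleftrightarrow> infinite G \<and>
     (\<forall>N. normal N (grp G) \<and> N \<noteq> {id} \<longrightarrow> finite (rcosets\<^bsub>grp G\<^esub> N))"

definition fin_gen :: "('a::finite) aut set \<Rightarrow> bool" where
  "fin_gen H \<longleftrightarrow> (\<exists>S. finite S \<and> S \<subseteq> H \<and> generate Aut_grp S = H)"

definition well_approximated :: "('a::finite) aut set \<Rightarrow> bool" where
  "well_approximated G \<longleftrightarrow> (\<forall>H. subgroup H (grp G) \<and> fin_gen H \<longrightarrow>
     (\<Inter>n. H <#>\<^bsub>grp G\<^esub> stab_level G n) = H)"

definition infra_direct :: "('a::finite) aut set \<Rightarrow> 'a aut set \<Rightarrow> 'a list set \<Rightarrow> bool" where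
  "infra_direct G H Y \<longleftrightarrow> (\<forall>y\<in>Y. fin_index (psi y (stab_set H Y)) G)"

definition GN_alternative :: "('a::finite) aut set \<Rightarrow> bool" where
  "GN_alternative G \<longleftrightarrow> (\<forall>H. subgroup H (grp G) \<and> fin_gen H \<longrightarrow>
     (\<exists>y. finite (psi y H)) \<or> (\<exists>Y. leaf_set Y \<and> spanning Y \<and> infra_direct G H Y))"

definition Sub :: "('a::finite) aut set \<Rightarrow> 'a aut set set" where
  "Sub G = {H. subgroup H (grp G)}"

definition chabauty :: "('a::finite) aut set \<Rightarrow> 'a aut set topology" where
  "chabauty G = pullback_topology (Sub G) (\<lambda>H. restrict (\<lambda>g. g \<in> H) G)
                   (product_topology (\<lambda>_. discrete_topology (UNIV::bool set)) G)"

definition cb_deriv :: "'b topology \<Rightarrow> 'b set \<Rightarrow> 'b set" where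
  "cb_deriv T Z = Z \<inter> (T derived_set_of Z)"

(* the transfinite sequence Z^alpha, described without ordinals: the smallest family
   containing Z, closed under successor (derivative) and under intersections
   (limit stages) *)
inductive_set cb_iterates :: "'b topology \<Rightarrow> 'b set \<Rightarrow> 'b set set"
  for T Z where
  base: "Z \<in> cb_iterates T Z"
| succ: "A \<in> cb_iterates T Z \<Longrightarrow> cb_deriv T A \<in> cb_iterates T Z"
| lim: "(\<And>A. A \<in> F \<Longrightarrow> A \<in> cb_iterates T Z) \<Longrightarrow> F \<noteq> {} \<Longrightarrow> \<Inter>F \<in> cb_iterates T Z"

definition perfect_kernel :: "'b topology \<Rightarrow> 'b set \<Rightarrow> 'b set" where
  "perfect_kernel T Z = (THE P. P \<in> cb_iterates T Z \<and> cb_deriv T P = P)"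

end

theory Submission
  imports Defs
begin

text \<open>
  Let \<open>K\<close> be a branching subgroup. A normal subgroup \<open>N\<close> of a finite index subgroup of \<open>G\<close> contains,
  below each vertex it moves, a copy of a finite index subgroup of \<open>G\<close> (double commutators and just
  infiniteness); since a finite index subgroup has boundedly many orbits on the levels, \<open>N\<close> is
  finitely generated. Projecting to the vertices of a spanning leaf set one after the other, every
  infra-direct product is finitely generated. Hence in the second case of the alternative all
  overgroups of \<open>H\<close> are finitely generated, so they satisfy the ascending chain condition, and
  a maximal one in a perfect set would be isolated.

  Conversely, the subgroups with a finite section or without finite generating set have no isolated
  point among them: if \<open>H\<close> is not finitely generated, it is the limit of its finitely generated
  subgroups, all of which have a finite section by the above; if \<open>H\<close> is finitely generated with
  finite \<open>psi y H\<close>, adjoin a copy of \<open>K\<close> below a deep vertex under \<open>y\<close>, which stays close to \<open>H\<close>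
  because \<open>H\<close> is well-approximated.
\<close>

subsection \<open>Tree automorphisms and sections\<close>

abbreviation ainv :: "'a aut \<Rightarrow> 'a aut" where
  "ainv g \<equiv> inv_into UNIV g"

lemma tree_aut_bij: "is_tree_aut g \<Longrightarrow> bij g"
  by (simp add: is_tree_aut_def)

lemma tree_aut_prefix_iff: "is_tree_aut g \<Longrightarrow> prefix (g u) (g v) \<longleftrightarrow> prefix u v"
  by (simp add: is_tree_aut_def)

lemma tree_aut_eq_iff: "is_tree_aut g \<Longrightarrow> g u = g v \<longleftrightarrow> u = v"
  by (metis bij_pointE tree_aut_bij)

lemma tree_aut_ainv_left [simp]: "is_tree_aut g \<Longrightarrow> ainv g (g x) = x"
  by (simp add: bij_is_inj tree_aut_bij)

lemma tree_aut_ainv_right [simp]: "is_tree_aut g \<Longrightarrow> g (ainv g x) = x"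
  by (simp add: bij_is_surj surj_f_inv_f tree_aut_bij)

lemma tree_aut_comp_ainv [simp]:
  assumes "is_tree_aut g"
  shows "g \<circ> ainv g = id" "ainv g \<circ> g = id"
  using assms by (auto simp: fun_eq_iff)

lemma tree_aut_id [simp]: "is_tree_aut id"
  by (auto simp: is_tree_aut_def bij_def)

lemma tree_aut_comp [simp]: "is_tree_aut g \<Longrightarrow> is_tree_aut h \<Longrightarrow> is_tree_aut (g \<circ> h)"
  by (simp add: is_tree_aut_def bij_comp)

lemma tree_aut_ainv [simp]:
  assumes "is_tree_aut g"
  shows "is_tree_aut (ainv g)"
proof -
  have "prefix u v \<longleftrightarrow> prefix (ainv g u) (ainv g v)" for u v
    by (subst tree_aut_prefix_iff[OF assms, symmetric]) (simp add: assms)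
  then show ?thesis
    using assms by (simp add: is_tree_aut_def[of "ainv g"] bij_imp_bij_inv tree_aut_bij)
qed

lemma ainv_eqI:
  assumes "is_tree_aut g" "g \<circ> h = id"
  shows "ainv g = h"
proof
  fix x
  have "g (h x) = x" using assms(2) by (simp add: fun_eq_iff)
  then show "ainv g x = h x" using assms(1) tree_aut_ainv_left by metis
qed

lemma ainv_comp: "is_tree_aut g \<Longrightarrow> is_tree_aut h \<Longrightarrow> ainv (g \<circ> h) = ainv h \<circ> ainv g"
  by (simp add: o_inv_distrib tree_aut_bij)

lemma ainv_ainv [simp]: "is_tree_aut g \<Longrightarrow> ainv (ainv g) = g"
  by (simp add: inv_inv_eq tree_aut_bij)

lemma ainv_id [simp]: "ainv id = id"
  by (rule ainv_eqI) auto

section \<open>The automorphism group of the tree and its subgroups\<close>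

lemma group_Aut_grp: "group Aut_grp"
proof (rule groupI)
  fix x assume "x \<in> carrier Aut_grp"
  then show "\<exists>y\<in>carrier Aut_grp. y \<otimes>\<^bsub>Aut_grp\<^esub> x = \<one>\<^bsub>Aut_grp\<^esub>"
    by (intro bexI[of _ "ainv x"]) (auto simp: Aut_grp_def)
qed (auto simp: Aut_grp_def comp_assoc)

lemma m_inv_Aut_grp:
  assumes "is_tree_aut g"
  shows "m_inv Aut_grp g = ainv g"
  by (rule group.inv_equality[OF group_Aut_grp]) (use assms in \<open>auto simp: Aut_grp_def\<close>)

lemma subgroup_Aut_grp_iff:
  "subgroup H Aut_grp \<longleftrightarrow> (\<forall>a\<in>H. is_tree_aut a) \<and> id \<in> H \<and>
     (\<forall>a\<in>H. \<forall>b\<in>H. a \<circ> b \<in> H) \<and> (\<forall>a\<in>H. ainv a \<in> H)"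
  by (auto simp: subgroup_def m_inv_Aut_grp Aut_grp_def m_inv_Aut_grp[unfolded Aut_grp_def] subset_eq)

lemma subgroup_Aut_grpI:
  assumes "\<And>a. a \<in> H \<Longrightarrow> is_tree_aut a" "id \<in> H"
    "\<And>a b. a \<in> H \<Longrightarrow> b \<in> H \<Longrightarrow> a \<circ> b \<in> H" "\<And>a. a \<in> H \<Longrightarrow> ainv a \<in> H"
  shows "subgroup H Aut_grp"
  using assms by (simp add: subgroup_Aut_grp_iff)

lemma subgroup_Aut_grpD:
  assumes "subgroup H Aut_grp"
  shows "a \<in> H \<Longrightarrow> is_tree_aut a" "id \<in> H" "a \<in> H \<Longrightarrow> b \<in> H \<Longrightarrow> a \<circ> b \<in> H"
    "a \<in> H \<Longrightarrow> ainv a \<in> H"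
  using assms by (simp_all add: subgroup_Aut_grp_iff)

text \<open>Lets the later arguments speak of subgroups of \<open>Aut_grp\<close> and inclusions
  only, with the same operations \<open>\<circ>\<close>, \<open>ainv\<close> and \<open>id\<close>
  for every group that occurs.\<close>

lemma subgroup_grp_iff:
  assumes "subgroup G Aut_grp"
  shows "subgroup H (grp G) \<longleftrightarrow> subgroup H Aut_grp \<and> H \<subseteq> G"
  unfolding grp_def
  using group.incl_subgroup[OF group_Aut_grp assms] group.subgroup_incl[OF group_Aut_grp _ assms]
    subgroup.subset[of H "Aut_grp\<lparr>carrier := G\<rparr>"] by auto

lemma mult_grp: "a \<otimes>\<^bsub>grp G\<^esub> b = a \<circ> b"
  by (simp add: grp_def Aut_grp_def)

lemma m_inv_grp: "subgroup G Aut_grp \<Longrightarrow> a \<in> G \<Longrightarrow> m_inv (grp G) a = ainv a"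
  unfolding grp_def
  using group.m_inv_consistent[OF group_Aut_grp, of G a] subgroup_Aut_grpD(1) m_inv_Aut_grp by metis

lemma normal_grp_iff:
  assumes "subgroup G Aut_grp"
  shows "normal N (grp G) \<longleftrightarrow>
    subgroup N Aut_grp \<and> N \<subseteq> G \<and> (\<forall>g\<in>G. \<forall>n\<in>N. g \<circ> n \<circ> ainv g \<in> N)"
proof -
  have gr: "group (grp G)"
    unfolding grp_def using assms group_Aut_grp by (rule subgroup.subgroup_is_group)
  have "carrier (grp G) = G" by (simp add: grp_def)
  then show ?thesis
    unfolding group.normal_inv_iff[OF gr]
    using subgroup_grp_iff[OF assms, of N] by (auto simp: mult_grp m_inv_grp[OF assms])
qed

lemma generate_Aut_grp_subgroup:
  assumes "\<And>s. s \<in> S \<Longrightarrow> is_tree_aut s"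
  shows "subgroup (generate Aut_grp S) Aut_grp"
  using group.generate_is_subgroup[OF group_Aut_grp, of S] assms by (auto simp: Aut_grp_def)

lemma generate_Aut_grp_subset:
  assumes "subgroup H Aut_grp" "S \<subseteq> H"
  shows "generate Aut_grp S \<subseteq> H"
  using group.generate_subgroup_incl[OF group_Aut_grp] assms by blast

lemma generate_Aut_grp_induct [consumes 1, case_names aut incl inv id comp]:
  assumes "a \<in> generate Aut_grp S"
    and S: "\<And>s. s \<in> S \<Longrightarrow> is_tree_aut s"
    and "\<And>s. s \<in> S \<Longrightarrow> P s" "\<And>s. s \<in> S \<Longrightarrow> P (ainv s)" "P id"
    and "\<And>a b. a \<in> generate Aut_grp S \<Longrightarrow> b \<in> generate Aut_grp S \<Longrightarrow> P a \<Longrightarrow> P b \<Longrightarrow> P (a \<circ> b)"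
  shows "P a"
  using assms(1)
proof induction
  case one
  have "\<one>\<^bsub>Aut_grp\<^esub> = (id :: 'a aut)" by (simp add: Aut_grp_def)
  then show ?case using assms(5) by metis
next
  case (inv h)
  then show ?case using assms by (simp add: m_inv_Aut_grp)
next
  case (eng a b)
  moreover have "a \<otimes>\<^bsub>Aut_grp\<^esub> b = a \<circ> b" by (simp add: Aut_grp_def)
  ultimately show ?case using assms(6)[of a b] by metis
qed (use assms in auto)

text \<open>An automorphism maps the prefixes of \<open>u\<close> bijectively onto those of
  \<open>g u\<close>, and a word of length \<open>n\<close> has \<open>n + 1\<close>
  prefixes.\<close>

lemma tree_aut_length [simp]:
  assumes "is_tree_aut g"
  shows "length (g u) = length u"
proof -
  have "g ` {p. prefix p u} = {p. prefix p (g u)}"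
  proof (intro equalityI subsetI)
    fix p assume "p \<in> {p. prefix p (g u)}"
    then have "prefix (ainv g p) u"
      using tree_aut_prefix_iff[OF assms, of "ainv g p" u] assms by simp
    then show "p \<in> g ` {p. prefix p u}"
      using assms by (intro image_eqI[of _ _ "ainv g p"]) auto
  qed (use assms in \<open>auto simp: tree_aut_prefix_iff\<close>)
  moreover have "inj_on g {p. prefix p u}"
    using assms by (auto simp: inj_on_def tree_aut_eq_iff)
  ultimately have "card {p. prefix p u} = card {p. prefix p (g u)}"
    by (metis card_image)
  moreover have "card {p. prefix p w} = Suc (length w)" for w :: "'a list"
  proof -
    have "{p. prefix p w} = set (prefixes w)" by auto
    then show ?thesis by (simp add: distinct_card)
  qed
  ultimately show ?thesis by simp
qed

lemma tree_aut_Nil [simp]: "is_tree_aut g \<Longrightarrow> g [] = []"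
  by (metis length_0_conv tree_aut_length)

lemma tree_aut_append:
  assumes "is_tree_aut g"
  shows "g (u @ w) = g u @ sect g u w"
proof -
  have "prefix (g u) (g (u @ w))" using assms by (simp add: tree_aut_prefix_iff)
  then show ?thesis by (auto simp: sect_def prefix_def)
qed

lemma tree_aut_take:
  assumes "is_tree_aut g"
  shows "g (take m u) = take m (g u)"
  using tree_aut_append[OF assms, of "take m u" "drop m u"] assms
  by (cases "m \<le> length u") (auto)

lemma sect_tree_aut [simp]:
  assumes "is_tree_aut g"
  shows "is_tree_aut (sect g u)"
  unfolding is_tree_aut_def
proof (intro conjI allI bijI injI surjI)
  fix v w
  assume "sect g u v = sect g u w"
  then have "g (u @ v) = g (u @ w)" using assms by (simp add: tree_aut_append)
  then show "v = w" using assms by (simp add: tree_aut_eq_iff)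
next
  fix w
  have "prefix (g u) (g (ainv g (g u @ w)))" using assms by simp
  then have "prefix u (ainv g (g u @ w))" using assms by (simp add: tree_aut_prefix_iff del: tree_aut_ainv_right)
  then obtain w' where "ainv g (g u @ w) = u @ w'" by (auto simp: prefix_def)
  then have "g u @ w = g (u @ w')" using assms by (metis tree_aut_ainv_right)
  then have "sect g u w' = w" using assms by (simp add: tree_aut_append)
  moreover have "drop (length u) (ainv g (g u @ w)) = w'"
    using \<open>ainv g (g u @ w) = u @ w'\<close> by simp
  ultimately show "sect g u (drop (length u) (ainv g (g u @ w))) = w" by simp
next
  fix v w
  have "prefix (u @ v) (u @ w) \<longleftrightarrow> prefix (g (u @ v)) (g (u @ w))"
    using assms by (simp only: tree_aut_prefix_iff)
  then show "prefix v w \<longleftrightarrow> prefix (sect g u v) (sect g u w)"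
    using assms by (simp add: tree_aut_append)
qed

lemma sect_id [simp]: "sect id u = id"
  by (simp add: sect_def fun_eq_iff)

lemma sect_comp: "is_tree_aut g \<Longrightarrow> is_tree_aut h \<Longrightarrow> sect (g \<circ> h) u = sect g (h u) \<circ> sect h u"
  by (rule ext) (simp add: sect_def[of "g \<circ> h"] tree_aut_append)

lemma sect_append:
  assumes "is_tree_aut g"
  shows "sect g (u @ v) = sect (sect g u) v"
proof
  fix w
  show "sect g (u @ v) w = sect (sect g u) v w"
    using tree_aut_append[OF assms, of "u @ v" w] tree_aut_append[OF assms, of u "v @ w"]
      tree_aut_append[OF assms, of u v] tree_aut_append[OF sect_tree_aut[OF assms], of u v w]
    by simp
qed

lemma sect_ainv:
  assumes "is_tree_aut g"
  shows "sect (ainv g) (g u) = ainv (sect g u)"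
proof -
  \<comment> \<open>As a section of \<open>ainv g \<circ> g\<close>, the composite of the two
    sections is the identity. \<open>ainv_eqI\<close> inverts its left factor, so one more inversion
    is needed afterwards.\<close>
  have "ainv (ainv (sect g u)) = ainv (sect (ainv g) (g u))"
    using sect_comp[of "ainv g" g u] assms by (simp add: ainv_eqI[symmetric])
  then have "ainv (ainv (ainv (sect g u))) = ainv (ainv (sect (ainv g) (g u)))" by simp
  then show ?thesis using assms by simp
qed

lemma sect_ainv_fix: "is_tree_aut g \<Longrightarrow> g u = u \<Longrightarrow> sect (ainv g) u = ainv (sect g u)"
  using sect_ainv by metis

lemma ainv_fix: "is_tree_aut g \<Longrightarrow> g u = u \<Longrightarrow> ainv g u = u"
  using tree_aut_ainv_left by metis

text \<open>Any word extends to one long enough to run through \<open>Y\<close>; such an extension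
  is fixed, and so are its prefixes.\<close>

lemma tree_aut_eq_id_spanning:
  fixes g :: "'a aut"
  assumes g: "is_tree_aut g" and Y: "spanning Y" "\<And>y. y \<in> Y \<Longrightarrow> g y = y \<and> sect g y = id"
  shows "g = id"
proof
  fix x :: "'a list"
  obtain N where N: "\<And>x. length x \<ge> N \<Longrightarrow> \<exists>y\<in>Y. prefix y x"
    using Y(1) by (auto simp: spanning_def)
  let ?x = "x @ replicate N undefined"
  obtain y w where "y \<in> Y" "?x = y @ w" using N[of ?x] by (auto simp: prefix_def)
  then have "g ?x = ?x" using Y(2) g by (metis id_apply tree_aut_append)
  then show "g x = id x" using g by (simp add: tree_aut_append)
qed

lemma finite_level: "finite (level n :: ('a::finite) list set)"
  using finite_lists_length_eq[of "UNIV :: 'a set" n] by (simp add: level_def)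

lemma spanning_level: "spanning (level n)"
proof -
  have "\<exists>y\<in>level n. prefix y x" if "length x \<ge> n" for x :: "'a list"
    using that by (intro bexI[of _ "take n x"]) (auto simp: level_def take_is_prefix)
  then show ?thesis unfolding spanning_def by blast
qed

subsection \<open>Automorphisms supported below a vertex\<close>

text \<open>The embedding of a group as its copy below \<open>x\<close>:
  \<open>aut_pow_singleton\<close> identifies the image of \<open>K\<close> with
  \<open>aut_pow K {x}\<close>. The explicit map makes products and conjugates easy to
  compute.\<close>

definition spread :: "'a list \<Rightarrow> 'a aut \<Rightarrow> 'a aut" where
  "spread x k v = (if prefix x v then x @ k (drop (length x) v) else v)"

lemma spread_append [simp]: "spread x k (x @ w) = x @ k w"
  by (simp add: spread_def)

lemma spread_other: "\<not> prefix x v \<Longrightarrow> spread x k v = v"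
  by (simp add: spread_def)

lemma spread_id [simp]: "spread x id = id"
  by (auto simp: spread_def fun_eq_iff prefix_def)

lemma spread_comp: "spread x (a \<circ> b) = spread x a \<circ> spread x b"
  by (auto simp: spread_def fun_eq_iff prefix_def)

lemma spread_self: "is_tree_aut k \<Longrightarrow> spread x k x = x"
  using spread_append[of x k "[]"] by simp

lemma spread_prefix:
  assumes "is_tree_aut k" "prefix u v"
  shows "prefix (spread x k u) (spread x k v)"
proof (cases "prefix x u")
  case True
  then obtain w where u: "u = x @ w" by (auto simp: prefix_def)
  then obtain w' where "v = x @ w @ w'" using assms(2) by (auto simp: prefix_def)
  then show ?thesis using u assms by (simp add: tree_aut_append)
next
  case False
  show ?thesis
  proof (cases "prefix x v")
    case True
    then have "prefix u x" using False assms(2) by (metis prefix_same_cases)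
    then show ?thesis using True False assms(2) by (simp add: spread_def)
  qed (use False assms in \<open>simp add: spread_def\<close>)
qed

lemma spread_inverse:
  assumes "is_tree_aut k"
  shows "spread x k \<circ> spread x (ainv k) = id" "spread x (ainv k) \<circ> spread x k = id"
  using spread_comp[of x k "ainv k"] spread_comp[of x "ainv k" k] assms by auto

lemma spread_tree_aut [simp]:
  assumes "is_tree_aut k"
  shows "is_tree_aut (spread x k)"
  unfolding is_tree_aut_def
proof (intro conjI allI iffI)
  show "bij (spread x k)" using spread_inverse[OF assms] by (rule o_bij[rotated])
next
  fix u v
  assume "prefix (spread x k u) (spread x k v)"
  then have "prefix (spread x (ainv k) (spread x k u)) (spread x (ainv k) (spread x k v))"
    using assms by (simp add: spread_prefix)
  then show "prefix u v" using spread_inverse(2)[OF assms, of x] by (simp add: fun_eq_iff)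
qed (use assms spread_prefix in auto)

lemma ainv_spread: "is_tree_aut k \<Longrightarrow> ainv (spread x k) = spread x (ainv k)"
  by (simp add: ainv_eqI spread_inverse)

lemma sect_spread [simp]: "is_tree_aut k \<Longrightarrow> sect (spread x k) x = k"
  by (simp add: sect_def spread_self fun_eq_iff)

lemma sect_spread_other:
  assumes "length y = length x" "y \<noteq> x"
  shows "sect (spread x k) y = id"
proof -
  have "\<not> prefix x (y @ w)" for w
    using assms by (auto simp: prefix_def append_eq_append_conv_if)
  from spread_other[OF this] spread_other[OF this[of "[]"]] show ?thesis
    by (simp add: sect_def fun_eq_iff)
qed

text \<open>Distinct vertices of one level have disjoint subtrees, so at any word one of the two
  factors acts trivially.\<close>

lemma spread_commute:
  assumes "is_tree_aut a" "is_tree_aut b" "length x = length y" "x \<noteq> y"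
  shows "spread x a \<circ> spread y b = spread y b \<circ> spread x a"
proof
  fix v
  have "\<not> (prefix x v \<and> prefix y v)"
    using assms by (auto simp: prefix_def)
  moreover have "\<not> prefix x (y @ w)" "\<not> prefix y (x @ w)" for w
    using assms by (auto simp: prefix_def append_eq_append_conv_if)
  ultimately show "(spread x a \<circ> spread y b) v = (spread y b \<circ> spread x a) v"
    by (auto simp: spread_def)
qed

text \<open>Conjugation by \<open>g\<close> transports the support from the subtree of
  \<open>x\<close> to that of \<open>g x\<close>, and the section of \<open>g\<close> translates
  between the two subtrees.\<close>

lemma spread_conj:
  assumes "is_tree_aut g" "is_tree_aut k"
  shows "g \<circ> spread x k \<circ> ainv g = spread (g x) (sect g x \<circ> k \<circ> ainv (sect g x))"
proof -
  have "g \<circ> spread x k = spread (g x) (sect g x \<circ> k \<circ> ainv (sect g x)) \<circ> g"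
  proof
    fix v
    show "(g \<circ> spread x k) v = (spread (g x) (sect g x \<circ> k \<circ> ainv (sect g x)) \<circ> g) v"
    proof (cases "prefix x v")
      case True
      then obtain w where "v = x @ w" by (auto simp: prefix_def)
      then show ?thesis using assms by (simp add: tree_aut_append)
    next
      case False
      then show ?thesis using assms by (simp add: spread_def tree_aut_prefix_iff)
    qed
  qed
  then show ?thesis using assms by (metis comp_assoc comp_id tree_aut_comp_ainv(1))
qed

lemma aut_pow_singleton:
  assumes "\<And>k. k \<in> K \<Longrightarrow> is_tree_aut k"
  shows "aut_pow K {x} = spread x ` K"
proof (intro equalityI subsetI)
  fix g assume g: "g \<in> aut_pow K {x}"
  have "g = spread x (sect g x)"
  proof
    fix v
    show "g v = spread x (sect g x) v"
      using g by (auto simp: aut_pow_def spread_def prefix_def tree_aut_append)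
  qed
  then show "g \<in> spread x ` K" using g by (auto simp: aut_pow_def)
qed (auto simp: aut_pow_def assms spread_self spread_other)

subsection \<open>Finite index\<close>

text \<open>Finite index is expressed through a finite transversal: in this form it makes sense for
  arbitrary sets, and any map with finite image that separates cosets witnesses it.\<close>

definition fidx :: "'a aut set \<Rightarrow> 'a aut set \<Rightarrow> bool" where
  "fidx H G \<longleftrightarrow> (\<exists>T. finite T \<and> T \<subseteq> G \<and> (\<forall>g\<in>G. \<exists>t\<in>T. g \<circ> ainv t \<in> H))"

lemma fidxI:
  assumes "finite (f ` G)"
    and "\<And>a b. a \<in> G \<Longrightarrow> b \<in> G \<Longrightarrow> f a = f b \<Longrightarrow> a \<circ> ainv b \<in> H"
  shows "fidx H G"
  unfolding fidx_def
proof (intro exI conjI ballI)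
  let ?T = "(\<lambda>y. inv_into G f y) ` f ` G"
  show "finite ?T" using assms(1) by blast
  show "?T \<subseteq> G" by (auto simp: inv_into_into)
  fix g assume "g \<in> G"
  then show "\<exists>t\<in>?T. g \<circ> ainv t \<in> H"
    by (intro bexI[of _ "inv_into G f (f g)"] assms(2)) (auto simp: inv_into_into f_inv_into_f)
qed

lemma comp_ainv_cancel:
  assumes "is_tree_aut t"
  shows "(a \<circ> ainv t) \<circ> t = a" "(a \<circ> t) \<circ> ainv t = a"
  using assms by (simp_all add: comp_assoc)

text \<open>Turns a transversal into a choice function \<open>r\<close>. Elements with the same
  representative lie in one right coset of \<open>H\<close>, which is what \<open>fidxI\<close> asks
  for.\<close>

lemma fidxE:
  assumes "fidx H G" "subgroup H Aut_grp" "\<And>g. g \<in> G \<Longrightarrow> is_tree_aut g"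
  obtains r where "finite (r ` G)" "r ` G \<subseteq> G" "\<And>g. g \<in> G \<Longrightarrow> g \<circ> ainv (r g) \<in> H"
    "\<And>a b. a \<in> G \<Longrightarrow> b \<in> G \<Longrightarrow> r a = r b \<Longrightarrow> a \<circ> ainv b \<in> H"
proof -
  obtain T where T: "finite T" "T \<subseteq> G" "\<forall>g\<in>G. \<exists>t\<in>T. g \<circ> ainv t \<in> H"
    using assms(1) by (auto simp: fidx_def)
  then obtain r where r: "\<And>g. g \<in> G \<Longrightarrow> r g \<in> T \<and> g \<circ> ainv (r g) \<in> H" by metis
  have "a \<circ> ainv b \<in> H" if "a \<in> G" "b \<in> G" "r a = r b" for a b
  proof -
    have ta: "is_tree_aut a" "is_tree_aut b" "is_tree_aut (r b)"
      using that r[of b] T(2) assms(3) by auto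
    have "(a \<circ> ainv (r b)) \<circ> ainv (b \<circ> ainv (r b)) \<in> H"
      using r[of a] r[of b] that subgroup_Aut_grpD(3,4)[OF assms(2)] by metis
    moreover have "(a \<circ> ainv (r b)) \<circ> ainv (b \<circ> ainv (r b)) = a \<circ> ainv b"
      using ta by (simp add: ainv_comp fun_eq_iff)
    ultimately show ?thesis by simp
  qed
  moreover have "r ` G \<subseteq> T" using r by auto
  ultimately show ?thesis
    using that[of r] r T(1,2) finite_subset[of "r ` G" T] by blast
qed

lemma finite_rcosets_iff:
  assumes "subgroup G Aut_grp" "subgroup H Aut_grp"
  shows "finite (rcosets\<^bsub>grp G\<^esub> H) \<longleftrightarrow> fidx H G"
proof -
  let ?c = "\<lambda>a. (\<lambda>h. h \<circ> a) ` H"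
  have co: "rcosets\<^bsub>grp G\<^esub> H = ?c ` G"
    by (auto simp: RCOSETS_def r_coset_def grp_def Aut_grp_def)
  note H = subgroup_Aut_grpD[OF assms(2)] and G = subgroup_Aut_grpD[OF assms(1)]
  show ?thesis
  proof
    assume "finite (rcosets\<^bsub>grp G\<^esub> H)"
    then show "fidx H G"
      unfolding co
    proof (rule fidxI)
      fix a b assume ab: "a \<in> G" "b \<in> G" "?c a = ?c b"
      have "id \<circ> a \<in> ?c a" using H(2) by blast
      then obtain h where "h \<in> H" "a = h \<circ> b" using ab(3) by auto
      then show "a \<circ> ainv b \<in> H" using G(1)[OF ab(2)] by (simp add: comp_ainv_cancel)
    qed
  next
    assume "fidx H G"
    then obtain r where r: "finite (r ` G)" "r ` G \<subseteq> G" "\<And>g. g \<in> G \<Longrightarrow> g \<circ> ainv (r g) \<in> H"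
      using fidxE assms(2) G(1) by metis
    have "?c a = ?c (r a)" if a: "a \<in> G" for a
    proof -
      have ra: "is_tree_aut (r a)" "is_tree_aut a" using r(2) a G(1) by auto
      let ?d = "a \<circ> ainv (r a)"
      have "h \<circ> a = (h \<circ> ?d) \<circ> r a" "h \<circ> r a = (h \<circ> ainv ?d) \<circ> a" for h
        using ra by (simp_all add: fun_eq_iff ainv_comp)
      moreover have "?d \<in> H" "ainv ?d \<in> H" using r(3)[OF a] H(4) by auto
      ultimately show ?thesis using H(3) by (auto simp: image_iff) blast+
    qed
    then have "?c ` G \<subseteq> ?c ` r ` G" by blast
    then show "finite (rcosets\<^bsub>grp G\<^esub> H)"
      unfolding co using r(1) finite_surj[of "r ` G"] by blast
  qed
qed

lemma fin_index_iff:
  assumes "subgroup G Aut_grp"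
  shows "fin_index H G \<longleftrightarrow> subgroup H Aut_grp \<and> H \<subseteq> G \<and> fidx H G"
  using finite_rcosets_iff[OF assms] subgroup_grp_iff[OF assms] by (auto simp: fin_index_def)

text \<open>Finitely many maps with finite image combine into one map to a finite product, to which
  \<open>fidxI\<close> applies.\<close>

lemma fidx_family:
  assumes "finite T" "\<And>t. t \<in> T \<Longrightarrow> finite (f t ` G)"
    and "\<And>a b. a \<in> G \<Longrightarrow> b \<in> G \<Longrightarrow> (\<And>t. t \<in> T \<Longrightarrow> f t a = f t b) \<Longrightarrow> a \<circ> ainv b \<in> H"
  shows "fidx H G"
proof (rule fidxI)
  let ?F = "\<lambda>a. restrict (\<lambda>t. f t a) T"
  have "?F ` G \<subseteq> (\<Pi>\<^sub>E t\<in>T. f t ` G)" by auto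
  moreover have "finite (\<Pi>\<^sub>E t\<in>T. f t ` G)" using assms(1,2) by (intro finite_PiE)
  ultimately show "finite (?F ` G)" by (rule finite_subset)
  fix a b assume ab: "a \<in> G" "b \<in> G" "?F a = ?F b"
  show "a \<circ> ainv b \<in> H"
    by (rule assms(3)[OF ab(1,2)]) (use ab(3) in \<open>metis restrict_apply\<close>)
qed

lemma fidx_mono: "fidx H G \<Longrightarrow> H \<subseteq> H' \<Longrightarrow> fidx H' G"
  unfolding fidx_def by (meson subsetD)

lemma fidx_preimage:
  assumes "fidx H G" "subgroup H Aut_grp" "\<And>g. g \<in> G \<Longrightarrow> is_tree_aut g"
    and "\<And>a. a \<in> A \<Longrightarrow> \<phi> a \<in> G"
    and "\<And>a b. a \<in> A \<Longrightarrow> b \<in> A \<Longrightarrow> \<phi> (a \<circ> ainv b) = \<phi> a \<circ> ainv (\<phi> b)"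
    and "\<And>a b. a \<in> A \<Longrightarrow> b \<in> A \<Longrightarrow> a \<circ> ainv b \<in> A"
  shows "fidx {a \<in> A. \<phi> a \<in> H} A"
proof -
  obtain r where r: "finite (r ` G)" "r ` G \<subseteq> G" "\<And>g. g \<in> G \<Longrightarrow> g \<circ> ainv (r g) \<in> H"
    "\<And>a b. a \<in> G \<Longrightarrow> b \<in> G \<Longrightarrow> r a = r b \<Longrightarrow> a \<circ> ainv b \<in> H"
    by (rule fidxE[OF assms(1,2,3)]) blast+
  show ?thesis
  proof (rule fidxI)
    show "finite ((r \<circ> \<phi>) ` A)"
      by (rule finite_subset[OF _ r(1)]) (use assms(4) in auto)
  qed (use r(4) assms(4-6) in auto)
qed

lemma fidx_trans:
  assumes "fidx K H" "fidx H G" "subgroup K Aut_grp" "subgroup H Aut_grp" "subgroup G Aut_grp"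
  shows "fidx K G"
proof -
  note H = subgroup_Aut_grpD[OF assms(4)] and G = subgroup_Aut_grpD[OF assms(5)]
  obtain r where r: "finite (r ` G)" "r ` G \<subseteq> G" "\<And>g. g \<in> G \<Longrightarrow> g \<circ> ainv (r g) \<in> H"
    using fidxE[OF assms(2,4)] G(1) by metis
  obtain s where s: "finite (s ` H)" "s ` H \<subseteq> H" "\<And>g. g \<in> H \<Longrightarrow> g \<circ> ainv (s g) \<in> K"
    "\<And>a b. a \<in> H \<Longrightarrow> b \<in> H \<Longrightarrow> s a = s b \<Longrightarrow> a \<circ> ainv b \<in> K"
    by (rule fidxE[OF assms(1,3) H(1)]) blast+
  \<comment> \<open>First the representative modulo \<open>H\<close>, then the one modulo
    \<open>K\<close> of the factor that remains in \<open>H\<close>.\<close>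
  let ?f = "\<lambda>g. (r g, s (g \<circ> ainv (r g)))"
  show ?thesis
  proof (rule fidxI)
    show "finite (?f ` G)"
      by (rule finite_subset[of _ "r ` G \<times> s ` H"]) (use r s in auto)
    fix a b assume ab: "a \<in> G" "b \<in> G" "?f a = ?f b"
    have ta: "is_tree_aut a" "is_tree_aut b" "is_tree_aut (r b)"
      using ab r(2) G(1) by auto
    have "(a \<circ> ainv (r b)) \<circ> ainv (b \<circ> ainv (r b)) \<in> K"
      using s(4) r(3) ab by (metis prod.inject)
    moreover have "(a \<circ> ainv (r b)) \<circ> ainv (b \<circ> ainv (r b)) = a \<circ> ainv b"
      using ta by (simp add: ainv_comp fun_eq_iff)
    ultimately show "a \<circ> ainv b \<in> K" by simp
  qed
qed

lemma fidx_infinite: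
  assumes "fidx H G" "infinite G" "\<And>g. g \<in> G \<Longrightarrow> is_tree_aut g"
  shows "infinite H"
proof
  assume "finite H"
  obtain T where T: "finite T" "T \<subseteq> G" "\<forall>g\<in>G. \<exists>t\<in>T. g \<circ> ainv t \<in> H"
    using assms(1) by (auto simp: fidx_def)
  have "G \<subseteq> (\<lambda>(h, t). h \<circ> t) ` (H \<times> T)"
  proof
    fix g assume "g \<in> G"
    then obtain t where "t \<in> T" "g \<circ> ainv t \<in> H" using T by blast
    moreover have "is_tree_aut t" using \<open>t \<in> T\<close> T assms by blast
    ultimately show "g \<in> (\<lambda>(h, t). h \<circ> t) ` (H \<times> T)"
      by (intro image_eqI[of _ _ "(g \<circ> ainv t, t)"]) (auto simp: comp_ainv_cancel)
  qed
  then show False using assms(2) \<open>finite H\<close> T(1) finite_subset by blast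
qed

subsection \<open>Finite generation\<close>

lemma fin_genE:
  assumes "fin_gen H" "subgroup H Aut_grp"
  obtains S where "finite S" "S \<subseteq> H" "generate Aut_grp S = H" "\<And>s. s \<in> S \<Longrightarrow> is_tree_aut s"
  using assms subgroup_Aut_grpD(1) unfolding fin_gen_def by (metis subsetD)

lemma fin_genI:
  assumes "subgroup H Aut_grp" "finite S" "S \<subseteq> H" "H \<subseteq> generate Aut_grp S"
  shows "fin_gen H"
  using assms generate_Aut_grp_subset[OF assms(1,3)] unfolding fin_gen_def by blast

lemma fin_gen_trivial: "fin_gen {id}"
proof (rule fin_genI[of _ "{}"])
  show "subgroup {id} Aut_grp" by (auto intro!: subgroup_Aut_grpI)
  show "{id} \<subseteq> generate Aut_grp {}"
    using generate.one[of Aut_grp "{}"] by (simp add: Aut_grp_def)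
qed auto

text \<open>Schreier's lemma: pushing a coset representative through a word in the generators of
  \<open>H\<close> leaves behind factors \<open>t \<circ> s \<circ> ainv t'\<close> in
  \<open>K\<close>, and there are only finitely many of these.\<close>

lemma schreier_fin_gen:
  assumes "fin_gen H" "subgroup H Aut_grp" "subgroup K Aut_grp" "K \<subseteq> H" "fidx K H"
  shows "fin_gen K"
proof -
  note H = subgroup_Aut_grpD[OF assms(2)] and K = subgroup_Aut_grpD[OF assms(3)]
  obtain S where S: "finite S" "S \<subseteq> H" "generate Aut_grp S = H" "\<And>s. s \<in> S \<Longrightarrow> is_tree_aut s"
    using fin_genE[OF assms(1,2)] by blast
  obtain r where r: "finite (r ` H)" "r ` H \<subseteq> H" "\<And>g. g \<in> H \<Longrightarrow> g \<circ> ainv (r g) \<in> K"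
    using fidxE[OF assms(5,3)] H(1) by metis
  \<comment> \<open>The identity is added to \<open>T\<close> and \<open>S'\<close> so that
    \<open>id\<close> lies in \<open>W\<close> and every \<open>t\<close> of \<open>T\<close> in
    \<open>K\<close> counts as a generator, through the triple \<open>(t, id, id)\<close>.\<close>
  define T where "T = insert id (r ` H)"
  define S' where "S' = insert id (S \<union> ainv ` S)"
  define U where "U = (\<lambda>(t, s, t'). t \<circ> s \<circ> ainv t') ` (T \<times> S' \<times> T) \<inter> K"
  have TH: "T \<subseteq> H" "S' \<subseteq> H" using r S(2) H by (auto simp: T_def S'_def)
  have UK: "U \<subseteq> K" by (auto simp: U_def)
  then have sU: "subgroup (generate Aut_grp U) Aut_grp"
    using K(1) by (intro generate_Aut_grp_subgroup) auto
  note gU = subgroup_Aut_grpD[OF sU]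
  have incl: "u \<in> U \<Longrightarrow> u \<in> generate Aut_grp U" for u by (rule generate.incl)
  \<comment> \<open>This set contains \<open>id\<close> and is closed under right multiplication by
    the generators and their inverses, so it contains \<open>H\<close>.\<close>
  define W where "W = {u \<circ> t | u t. u \<in> generate Aut_grp U \<and> t \<in> T}"
  have step: "w \<circ> s \<in> W" if w: "w \<in> W" and s: "s \<in> S'" for w s
  proof -
    obtain u t where u: "u \<in> generate Aut_grp U" "t \<in> T" "w = u \<circ> t" using w by (auto simp: W_def)
    have ts: "t \<circ> s \<in> H" using u(2) s TH H(3) by blast
    let ?t' = "r (t \<circ> s)"
    have t': "?t' \<in> T" "is_tree_aut ?t'" using ts r(2) H(1) by (auto simp: T_def)
    have "t \<circ> s \<circ> ainv ?t' \<in> U"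
      unfolding U_def using u(2) s t' r(3)[OF ts]
      by (intro IntI image_eqI[of _ _ "(t, s, ?t')"]) auto
    then have "u \<circ> (t \<circ> s \<circ> ainv ?t') \<in> generate Aut_grp U" using incl gU(3) u(1) by blast
    moreover have "w \<circ> s = (u \<circ> (t \<circ> s \<circ> ainv ?t')) \<circ> ?t'"
      using t'(2) u(3) by (simp add: fun_eq_iff)
    ultimately show ?thesis using t'(1) unfolding W_def by blast
  qed
  have idW: "id \<in> W" unfolding W_def T_def using gU(2) by (auto intro!: exI[of _ id])
  have "\<forall>w\<in>W. w \<circ> g \<in> W" if "g \<in> generate Aut_grp S" for g
    using that
  proof (induction rule: generate_Aut_grp_induct)
    case (comp a b)
    then show ?case by (metis comp_assoc)
  next
    case (incl s)
    then show ?case using step[of _ s] by (auto simp: S'_def simp del: comp_apply)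
  next
    case (inv s)
    then show ?case using step[of _ "ainv s"] by (auto simp: S'_def comp_def)
  qed (use S(4) in auto)
  then have HW: "H \<subseteq> W" using S(3) idW by fastforce
  have "K \<subseteq> generate Aut_grp U"
  proof
    fix k assume k: "k \<in> K"
    then obtain u t where u: "u \<in> generate Aut_grp U" "t \<in> T" "k = u \<circ> t"
      using HW assms(4) by (auto simp: W_def)
    have uK: "u \<in> K" using u(1) generate_Aut_grp_subset[OF assms(3) UK] by blast
    have "ainv u \<circ> k = t" using u(3) K(1)[OF uK] by (simp add: fun_eq_iff)
    then have "t \<in> K" using uK k K(3,4) by metis
    then have "t \<in> U" unfolding U_def using u(2)
      by (intro IntI image_eqI[of _ _ "(t, id, id)"]) (auto simp: T_def S'_def)
    then show "k \<in> generate Aut_grp U" using u incl gU(3) by blast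
  qed
  moreover have "finite U" using S(1) r(1) by (auto simp: U_def T_def S'_def)
  ultimately show ?thesis using fin_genI[OF assms(3)] UK by blast
qed

lemma fin_gen_fidx_overgroup:
  assumes "fin_gen K" "subgroup H Aut_grp" "subgroup K Aut_grp" "K \<subseteq> H" "fidx K H"
  shows "fin_gen H"
proof -
  note H = subgroup_Aut_grpD[OF assms(2)]
  obtain S where S: "finite S" "S \<subseteq> K" "generate Aut_grp S = K"
    using assms(1) by (auto simp: fin_gen_def)
  obtain T where T: "finite T" "T \<subseteq> H" "\<forall>g\<in>H. \<exists>t\<in>T. g \<circ> ainv t \<in> K"
    using assms(5) by (auto simp: fidx_def)
  have sub: "subgroup (generate Aut_grp (S \<union> T)) Aut_grp"
    using S(2) T(2) assms(4) H(1) by (intro generate_Aut_grp_subgroup) auto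
  have KL: "K \<subseteq> generate Aut_grp (S \<union> T)"
    using group.mono_generate[OF group_Aut_grp, of S "S \<union> T"] S(3) by auto
  have TL: "T \<subseteq> generate Aut_grp (S \<union> T)" by (auto intro: generate.incl)
  have "g \<in> generate Aut_grp (S \<union> T)" if g: "g \<in> H" for g
  proof -
    obtain t where t: "t \<in> T" "g \<circ> ainv t \<in> K" using T g by blast
    have "(g \<circ> ainv t) \<circ> t \<in> generate Aut_grp (S \<union> T)"
      by (rule subgroup_Aut_grpD(3)[OF sub]) (use t KL TL in auto)
    moreover have "(g \<circ> ainv t) \<circ> t = g"
      using t(1) T(2) H(1) by (intro comp_ainv_cancel) auto
    ultimately show ?thesis by simp
  qed
  then show ?thesis using fin_genI[OF assms(2), of "S \<union> T"] S T assms(4) by blast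
qed

text \<open>Lifts of generators of the image generate \<open>E\<close> together with generators of
  the kernel: an element differs from a lift of its image by a kernel element.\<close>

lemma fin_gen_extension:
  assumes E: "subgroup E Aut_grp"
    and hom: "\<And>a b. a \<in> E \<Longrightarrow> b \<in> E \<Longrightarrow> \<phi> (a \<circ> b) = \<phi> a \<circ> \<phi> b"
      "\<And>a. a \<in> E \<Longrightarrow> \<phi> (ainv a) = ainv (\<phi> a)" "\<And>a. a \<in> E \<Longrightarrow> is_tree_aut (\<phi> a)"
    and fg: "fin_gen (\<phi> ` E)" "fin_gen {e \<in> E. \<phi> e = id}"
  shows "fin_gen E"
proof -
  note Ed = subgroup_Aut_grpD[OF E]
  obtain S where S: "finite S" "S \<subseteq> \<phi> ` E" "generate Aut_grp S = \<phi> ` E"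
    using fg(1) by (auto simp: fin_gen_def)
  obtain S' where S': "S' \<subseteq> E" "finite S'" "S = \<phi> ` S'"
    using finite_subset_image[OF S(1,2)] by blast
  obtain T where T: "finite T" "T \<subseteq> {e \<in> E. \<phi> e = id}" "generate Aut_grp T = {e \<in> E. \<phi> e = id}"
    using fg(2) by (auto simp: fin_gen_def)
  let ?L = "generate Aut_grp (S' \<union> T)"
  have sub: "subgroup ?L Aut_grp"
    using S'(1) T(2) Ed(1) by (intro generate_Aut_grp_subgroup) auto
  note L = subgroup_Aut_grpD[OF sub]
  have LE: "?L \<subseteq> E" using generate_Aut_grp_subset[OF E] S'(1) T(2) by blast
  have ker: "{e \<in> E. \<phi> e = id} \<subseteq> ?L"
    using group.mono_generate[OF group_Aut_grp, of T "S' \<union> T"] T(3) by auto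
  have "\<phi> id \<circ> \<phi> id = \<phi> id" using hom(1)[of id id] Ed(2) by simp
  then have "\<phi> id \<circ> \<phi> id \<circ> ainv (\<phi> id) = id" using hom(3)[OF Ed(2)] by simp
  then have hid: "\<phi> id = id" using comp_ainv_cancel(2)[OF hom(3)[OF Ed(2)]] by metis
  have incl: "s \<in> S' \<Longrightarrow> s \<in> ?L" for s by (auto intro: generate.incl)
  have "\<exists>l\<in>?L. \<phi> l = a" if "a \<in> generate Aut_grp S" for a
    using that
  proof (induction rule: generate_Aut_grp_induct)
    case (inv s)
    then obtain s' where "s' \<in> S'" "s = \<phi> s'" using S'(3) by blast
    then show ?case using incl L(4) hom(2) LE by (intro bexI[of _ "ainv s'"]) auto
  next
    case (comp a b)
    then obtain l l' where "l \<in> ?L" "l' \<in> ?L" "\<phi> l = a" "\<phi> l' = b" by blast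
    moreover from this have "\<phi> (l \<circ> l') = a \<circ> b" using hom(1) LE by blast
    ultimately show ?case using L(3) by blast
  next
    case id
    then show ?case using hid L(2) by blast
  qed (use S' incl hom(3) in auto)
  then have lift: "\<exists>l\<in>?L. \<phi> l = \<phi> e" if "e \<in> E" for e using S(3) that by auto
  have "e \<in> ?L" if e: "e \<in> E" for e
  proof -
    obtain l where l: "l \<in> ?L" "\<phi> l = \<phi> e" using lift e by blast
    have "\<phi> (e \<circ> ainv l) = id"
      using hom(1)[of e "ainv l"] hom(2)[of l] hom(3)[of e] e l LE Ed(4) by auto
    then have "e \<circ> ainv l \<in> ?L" using ker e l(1) LE Ed(3,4) by blast
    then have "(e \<circ> ainv l) \<circ> l \<in> ?L" using l(1) L(3) by blast
    then show ?thesis using L(1)[OF l(1)] by (simp add: comp_ainv_cancel)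
  qed
  then show ?thesis using fin_genI[OF E, of "S' \<union> T"] S' T by blast
qed

section \<open>Sections at fixed vertices as homomorphisms\<close>

lemma sect_hom:
  assumes "is_tree_aut a" "is_tree_aut b" "b y = y"
  shows "sect (a \<circ> b) y = sect a y \<circ> sect b y"
  using assms by (simp add: sect_comp)

lemma psi_subgroup:
  assumes "subgroup E Aut_grp" "\<And>e. e \<in> E \<Longrightarrow> e y = y"
  shows "subgroup (psi y E) Aut_grp"
proof -
  note E = subgroup_Aut_grpD[OF assms(1)]
  show ?thesis
  proof (rule subgroup_Aut_grpI)
    show "id \<in> psi y E" using E(2) by (auto simp: psi_def image_iff intro!: bexI[of _ id])
    fix a assume "a \<in> psi y E"
    then obtain e where e: "e \<in> E" "a = sect e y" by (auto simp: psi_def)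
    then show "is_tree_aut a" using E by simp
    have "ainv a = sect (ainv e) y" using e E assms(2) by (simp add: sect_ainv_fix)
    then show "ainv a \<in> psi y E" using e E(4) by (auto simp: psi_def)
    fix b assume "b \<in> psi y E"
    then obtain f where f: "f \<in> E" "b = sect f y" by (auto simp: psi_def)
    then have "a \<circ> b = sect (e \<circ> f) y" using e E assms(2) by (simp add: sect_hom)
    then show "a \<circ> b \<in> psi y E" using e f E(3) by (auto simp: psi_def)
  qed
qed

lemma finite_psi_append:
  assumes "finite (psi y H)" "subgroup H Aut_grp"
  shows "finite (psi (y @ w) H)"
proof -
  have "psi (y @ w) H \<subseteq> (\<lambda>s. sect s w) ` psi y H"
    using subgroup_Aut_grpD(1)[OF assms(2)] by (auto simp: psi_def sect_append)
  then show ?thesis using assms(1) finite_surj by blast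
qed

lemma sect_id_subgroup:
  assumes "subgroup E Aut_grp" "\<And>e z. e \<in> E \<Longrightarrow> z \<in> Z \<Longrightarrow> e z = z"
  shows "subgroup {e \<in> E. \<forall>z\<in>Z. sect e z = id} Aut_grp"
proof -
  note E = subgroup_Aut_grpD[OF assms(1)]
  show ?thesis
    by (rule subgroup_Aut_grpI) (use E assms(2) in \<open>auto simp: sect_hom sect_ainv_fix\<close>)
qed

text \<open>Kill the sections at the vertices of \<open>Y\<close> one at a time: the successive quotients are the
  assumed finitely generated groups, and the last kernel is trivial because \<open>Y\<close> spans.\<close>

lemma fin_gen_via_sections:
  assumes E: "subgroup E Aut_grp" and Y: "finite Y" "spanning Y"
    and fx: "\<And>e y. e \<in> E \<Longrightarrow> y \<in> Y \<Longrightarrow> e y = y"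
    and fg: "\<And>Z y. Z \<subseteq> Y \<Longrightarrow> y \<in> Y \<Longrightarrow> fin_gen (psi y {e \<in> E. \<forall>z\<in>Z. sect e z = id})"
  shows "fin_gen E"
proof -
  note Ed = subgroup_Aut_grpD[OF E]
  \<comment> \<open>\<open>W\<close> collects the vertices whose sections are still free: for empty
    \<open>W\<close> only \<open>id\<close> is left, and for \<open>W = Y\<close> the group is
    \<open>E\<close> itself.\<close>
  have "fin_gen {e \<in> E. \<forall>z\<in>Y - W. sect e z = id}" if "finite W" "W \<subseteq> Y" for W
    using that
  proof (induction rule: finite_induct)
    case empty
    have "e = id" if "e \<in> E" "\<forall>z\<in>Y. sect e z = id" for e
      using tree_aut_eq_id_spanning[OF Ed(1)[OF that(1)] Y(2)] fx that by blast
    then have "{e \<in> E. \<forall>z\<in>Y. sect e z = id} = {id}" using Ed(2) by auto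
    then show ?case unfolding Diff_empty using fin_gen_trivial by metis
  next
    case (insert y W)
    let ?F = "{e \<in> E. \<forall>z\<in>Y - insert y W. sect e z = id}"
    have F: "subgroup ?F Aut_grp" using E by (rule sect_id_subgroup) (use fx in auto)
    have y: "y \<in> Y" using insert by auto
    have "{e \<in> ?F. sect e y = id} = {e \<in> E. \<forall>z\<in>Y - W. sect e z = id}"
      using y insert(2) by auto
    then have ker: "fin_gen {e \<in> ?F. sect e y = id}" using insert by (simp add: id_def)
    have im: "fin_gen ((\<lambda>e. sect e y) ` ?F)"
      using fg[of "Y - insert y W" y] y by (simp add: psi_def)
    show ?case
      by (rule fin_gen_extension[OF F _ _ _ im ker])
        (use Ed fx y in \<open>auto simp: sect_hom sect_ainv_fix\<close>)
  qed
  from this[OF Y(1)] show ?thesis by simp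
qed

subsection \<open>Branch groups\<close>

lemma stab_set_subgroup:
  assumes "subgroup E Aut_grp"
  shows "subgroup (stab_set E Y) Aut_grp"
  by (rule subgroup_Aut_grpI)
    (use subgroup_Aut_grpD[OF assms] in \<open>auto simp: stab_set_def ainv_fix\<close>)

lemma fidx_stab_set:
  fixes E :: "('a::finite) aut set"
  assumes "subgroup E Aut_grp" "finite Y"
  shows "fidx (stab_set E Y) E"
\<comment> \<open>The inverse matters: if \<open>ainv a\<close> and \<open>ainv b\<close> agree at
  \<open>y\<close>, then \<open>a \<circ> ainv b\<close> fixes \<open>y\<close>, as the right cosets
  of \<open>fidx\<close> demand.\<close>
proof (rule fidx_family[OF assms(2), where f = "\<lambda>y a. ainv a y"])
  note E = subgroup_Aut_grpD[OF assms(1)]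
  fix y :: "'a list"
  have "(\<lambda>a. ainv a y) ` E \<subseteq> level (length y)" using E(1) by (auto simp: level_def)
  then show "finite ((\<lambda>a. ainv a y) ` E)" using finite_level finite_subset by blast
next
  note E = subgroup_Aut_grpD[OF assms(1)]
  fix a b assume ab: "a \<in> E" "b \<in> E" "\<And>y. y \<in> Y \<Longrightarrow> ainv a y = ainv b y"
  have "a (ainv b y) = y" if "y \<in> Y" for y
    using ab(3)[OF that] E(1)[OF ab(1)] by (metis tree_aut_ainv_right)
  moreover have "a \<circ> ainv b \<in> E" using ab E(3,4) by blast
  ultimately show "a \<circ> ainv b \<in> stab_set E Y" by (simp add: stab_set_def)
qed

text \<open>The normal core, that is, the intersection of all conjugates of \<open>M\<close>.
  Finitely many conjugates suffice, because conjugation by elements of \<open>M\<close> preserves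
  \<open>M\<close>.\<close>

lemma fidx_core:
  assumes G: "subgroup G Aut_grp" and M: "subgroup M Aut_grp" "M \<subseteq> G" "fidx M G"
  obtains N where "subgroup N Aut_grp" "N \<subseteq> M" "fidx N G"
    "\<And>g n. g \<in> G \<Longrightarrow> n \<in> N \<Longrightarrow> g \<circ> n \<circ> ainv g \<in> N"
proof -
  note Gd = subgroup_Aut_grpD[OF G] and Md = subgroup_Aut_grpD[OF M(1)]
  obtain T where T: "finite T" "T \<subseteq> G" "\<forall>g\<in>G. \<exists>t\<in>T. g \<circ> ainv t \<in> M"
    using M(3) by (auto simp: fidx_def)
  obtain r where r: "finite (r ` G)" "r ` G \<subseteq> G" "\<And>g. g \<in> G \<Longrightarrow> g \<circ> ainv (r g) \<in> M"
    "\<And>a b. a \<in> G \<Longrightarrow> b \<in> G \<Longrightarrow> r a = r b \<Longrightarrow> a \<circ> ainv b \<in> M"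
    by (rule fidxE[OF M(3,1) Gd(1)]) blast+
  let ?N = "{m \<in> G. \<forall>g\<in>G. g \<circ> m \<circ> ainv g \<in> M}"
  have sub: "subgroup ?N Aut_grp"
  proof (rule subgroup_Aut_grpI)
    show "id \<in> ?N" using Gd Md(2) by simp
    fix a assume a: "a \<in> ?N"
    then show "is_tree_aut a" using Gd(1) by blast
    show "ainv a \<in> ?N"
    proof (intro CollectI conjI ballI)
      show "ainv a \<in> G" using a Gd(4) by blast
      fix g assume g: "g \<in> G"
      have "ainv (g \<circ> a \<circ> ainv g) \<in> M" using a g Md(4) by blast
      moreover have "is_tree_aut a" "is_tree_aut g" using a g Gd(1) by blast+
      ultimately show "g \<circ> ainv a \<circ> ainv g \<in> M" by (simp add: ainv_comp comp_assoc)
    qed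
    fix b assume b: "b \<in> ?N"
    show "a \<circ> b \<in> ?N"
    proof (intro CollectI conjI ballI)
      show "a \<circ> b \<in> G" using a b Gd(3) by blast
      fix g assume g: "g \<in> G"
      have "(g \<circ> a \<circ> ainv g) \<circ> (g \<circ> b \<circ> ainv g) \<in> M" using a b g Md(3) by blast
      moreover have "(g \<circ> a \<circ> ainv g) \<circ> (g \<circ> b \<circ> ainv g) = g \<circ> (a \<circ> b) \<circ> ainv g"
        using Gd(1)[OF g] by (simp add: fun_eq_iff)
      ultimately show "g \<circ> (a \<circ> b) \<circ> ainv g \<in> M" by simp
    qed
  qed
  have "?N \<subseteq> M" using Gd(2) by force
  moreover have "fidx ?N G"
  proof (rule fidx_family[OF T(1), where f = "\<lambda>t a. r (t \<circ> a)"])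
    fix t assume "t \<in> T"
    then have "(\<lambda>a. r (t \<circ> a)) ` G \<subseteq> r ` G" using T(2) Gd(3) by blast
    then show "finite ((\<lambda>a. r (t \<circ> a)) ` G)" using r(1) finite_subset by blast
  next
    fix a b assume ab: "a \<in> G" "b \<in> G" "\<And>t. t \<in> T \<Longrightarrow> r (t \<circ> a) = r (t \<circ> b)"
    show "a \<circ> ainv b \<in> ?N"
    proof (intro CollectI conjI ballI)
      show "a \<circ> ainv b \<in> G" using ab Gd(3,4) by blast
      fix g assume g: "g \<in> G"
      then obtain t where t: "t \<in> T" "g \<circ> ainv t \<in> M" using T(3) by blast
      have tG: "t \<in> G" using t(1) T(2) by blast
      \<comment> \<open>\<open>?c\<close> is the conjugate of \<open>a \<circ> ainv b\<close> by
        \<open>t\<close>, and lies in \<open>M\<close> because the cosets agree. Since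
        \<open>g\<close> is \<open>?m \<circ> t\<close>, conjugating further by \<open>?m\<close>
        gives the conjugate by \<open>g\<close>.\<close>
      let ?m = "g \<circ> ainv t" and ?c = "(t \<circ> a) \<circ> ainv (t \<circ> b)"
      have "?c \<in> M" using r(4) ab t(1) tG Gd(3) by blast
      then have "?m \<circ> ?c \<circ> ainv ?m \<in> M" using t(2) Md(3,4) by blast
      moreover have "is_tree_aut a" "is_tree_aut b" "is_tree_aut t" "is_tree_aut g"
        using ab tG g Gd(1) by auto
      ultimately show "g \<circ> (a \<circ> ainv b) \<circ> ainv g \<in> M"
        by (simp add: ainv_comp comp_assoc) (simp add: comp_def)
    qed
  qed
  moreover have "h \<circ> n \<circ> ainv h \<in> ?N" if h: "h \<in> G" and n: "n \<in> ?N" for h n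
  proof (intro CollectI conjI ballI)
    show "h \<circ> n \<circ> ainv h \<in> G" using h n Gd(3,4) by blast
    fix g assume g: "g \<in> G"
    have "(g \<circ> h) \<circ> n \<circ> ainv (g \<circ> h) \<in> M" using n g h Gd(3) by blast
    then show "g \<circ> (h \<circ> n \<circ> ainv h) \<circ> ainv g \<in> M"
      using Gd(1)[OF g] Gd(1)[OF h] by (simp add: ainv_comp comp_assoc)
  qed
  ultimately show ?thesis using that sub by blast
qed

text \<open>The number of \<open>D\<close>-orbits on a level is bounded by the index of \<open>D\<close>, so on the levels below
  one where it is maximal no orbit splits any further.\<close>

lemma fidx_orbits_stabilize:
  fixes G :: "('a::finite) aut set"
  assumes G: "subgroup G Aut_grp" "level_transitive G"
    and D: "subgroup D Aut_grp" "D \<subseteq> G" "fidx D G"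
  obtains m where "\<And>u v. m \<le> length u \<Longrightarrow> length u = length v \<Longrightarrow> take m u = take m v \<Longrightarrow> \<exists>d\<in>D. d u = v"
proof -
  note Gd = subgroup_Aut_grpD[OF G(1)] and Dd = subgroup_Aut_grpD[OF D(1)]
  define orb where "orb u = (\<lambda>d. d u) ` D" for u
  define Orb where "Orb n = orb ` level n" for n
  obtain T where T: "finite T" "T \<subseteq> G" "\<forall>g\<in>G. \<exists>t\<in>T. g \<circ> ainv t \<in> D"
    using D(3) by (auto simp: fidx_def)
  have orb_eq: "orb (d u) = orb u" if d: "d \<in> D" for d u
  proof (intro equalityI subsetI)
    fix x assume "x \<in> orb (d u)"
    then obtain e where "e \<in> D" "x = (e \<circ> d) u" by (auto simp: orb_def)
    then show "x \<in> orb u" using d Dd(3) unfolding orb_def by blast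
  next
    fix x assume "x \<in> orb u"
    then obtain e where e: "e \<in> D" "x = e u" by (auto simp: orb_def)
    then have "x = (e \<circ> ainv d) (d u)" using Dd(1)[OF d] by simp
    then show "x \<in> orb (d u)" using e(1) d Dd(3,4) unfolding orb_def by blast
  qed
  have card_le: "card (Orb n) \<le> card T" and fin: "finite (Orb n)" for n
  proof -
    define u0 :: "'a list" where "u0 = replicate n undefined"
    \<comment> \<open>By transitivity each vertex of the level is some \<open>g u0\<close>. Writing
      \<open>g\<close> as an element of \<open>D\<close> times some \<open>t\<close> in
      \<open>T\<close> shows that its orbit is that of \<open>t u0\<close>.\<close>
    have "Orb n \<subseteq> (\<lambda>t. orb (t u0)) ` T"
    proof
      fix x assume "x \<in> Orb n"
      then obtain u where u: "x = orb u" "u \<in> level n" by (auto simp: Orb_def)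
      obtain g where g: "g \<in> G" "g u0 = u"
        using G(2) u(2) unfolding level_transitive_def
        by (metis (mono_tags, lifting) length_replicate level_def mem_Collect_eq u0_def)
      obtain t where t: "t \<in> T" "g \<circ> ainv t \<in> D" using T(3) g(1) by blast
      then have "is_tree_aut t" using T(2) Gd(1) by blast
      then have "(g \<circ> ainv t) (t u0) = u" using g(2) by simp
      then have "orb u = orb (t u0)" using orb_eq[OF t(2), of "t u0"] by simp
      then show "x \<in> (\<lambda>t. orb (t u0)) ` T" using u(1) t(1) by blast
    qed
    then show "card (Orb n) \<le> card T" "finite (Orb n)"
      using T(1) surj_card_le[OF T(1)] finite_surj[OF T(1)] by blast+
  qed
  obtain m where m: "\<And>n. card (Orb n) \<le> card (Orb m)"
  proof -
    have fr: "finite (range (\<lambda>n. card (Orb n)))"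
      by (rule finite_subset[of _ "{..card T}"]) (use card_le in auto)
    then have "Max (range (\<lambda>n. card (Orb n))) \<in> range (\<lambda>n. card (Orb n))"
      by (intro Max_in) auto
    then obtain m where "Max (range (\<lambda>n. card (Orb n))) = card (Orb m)" by blast
    then show ?thesis
      using that[of m] Max_ge[OF fr] by (metis rangeI)
  qed
  have take_orb: "take m ` orb u = orb (take m u)" for u
    unfolding orb_def image_image using Dd(1) by (intro image_cong) (auto simp: tree_aut_take)
  show ?thesis
  proof (rule that[of m])
    fix u v :: "'a list"
    assume uv: "m \<le> length u" "length u = length v" "take m u = take m v"
    let ?n = "length u"
    \<comment> \<open>Truncation maps the orbits of the deeper level onto those of level
      \<open>m\<close>. By maximality of \<open>m\<close> it is injective, so vertices with the same
      truncation share an orbit.\<close>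
    have "Orb m \<subseteq> (\<lambda>A. take m ` A) ` Orb ?n"
    proof
      fix x assume "x \<in> Orb m"
      then obtain w where w: "x = orb w" "length w = m" by (auto simp: Orb_def level_def)
      let ?w = "w @ replicate (?n - m) undefined"
      have "take m ` orb ?w = x" using w by (simp add: take_orb)
      moreover have "orb ?w \<in> Orb ?n" using w uv(1) by (auto simp: Orb_def level_def)
      ultimately show "x \<in> (\<lambda>A. take m ` A) ` Orb ?n" by blast
    qed
    then have "card (Orb m) \<le> card ((\<lambda>A. take m ` A) ` Orb ?n)"
      using fin by (intro card_mono) auto
    then have "card ((\<lambda>A. take m ` A) ` Orb ?n) = card (Orb ?n)"
      using m[of ?n] card_image_le[OF fin, of "\<lambda>A. take m ` A" ?n] by linarith
    then have inj: "inj_on (\<lambda>A. take m ` A) (Orb ?n)" using fin eq_card_imp_inj_on by blast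
    have "orb u = orb v"
      by (rule inj_onD[OF inj]) (use uv in \<open>auto simp: take_orb Orb_def level_def\<close>)
    moreover have "id v \<in> orb v" using Dd(2) unfolding orb_def by blast
    ultimately have "v \<in> orb u" by simp
    then show "\<exists>d\<in>D. d u = v" by (auto simp: orb_def)
  qed
qed

text \<open>The algebraic hypotheses in working form: finite index as \<open>fidx\<close>, and the
  branching condition as closure of \<open>K\<close> under \<open>spread\<close>. Well-approximation
  and the alternative enter only in the final theorem.\<close>

locale just_infinite_branch =
  fixes G K :: "('a::finite) aut set"
  assumes G: "subgroup G Aut_grp"
    and fin_gen_G: "fin_gen G"
    and K: "subgroup K Aut_grp" "K \<subseteq> G" "fidx K G"
    and spread_K: "\<And>x k. k \<in> K \<Longrightarrow> spread x k \<in> K"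
    and self_similar: "\<And>g x. g \<in> G \<Longrightarrow> sect g x \<in> G"
    and transitive: "level_transitive G"
    and infinite_G: "infinite G"
    and quotients: "\<And>N. subgroup N Aut_grp \<Longrightarrow> N \<subseteq> G \<Longrightarrow>
      (\<And>g n. g \<in> G \<Longrightarrow> n \<in> N \<Longrightarrow> g \<circ> n \<circ> ainv g \<in> N) \<Longrightarrow> N \<noteq> {id} \<Longrightarrow> fidx N G"
begin

lemmas Gd = subgroup_Aut_grpD[OF G]
lemmas Kd = subgroup_Aut_grpD[OF K(1)]

lemma infinite_K: "infinite K"
  using fidx_infinite[OF K(3) infinite_G Gd(1)] by blast

text \<open>\<open>R x\<close> is the preimage of \<open>D\<close> under the embedding
  \<open>spread x\<close> of \<open>K\<close> into \<open>G\<close>, and preimages of finite index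
  subgroups have finite index.\<close>

lemma spread_preimage:
  assumes D: "subgroup D Aut_grp" "D \<subseteq> G" "fidx D G"
  defines "R \<equiv> \<lambda>x. {k \<in> K. spread x k \<in> D}"
  shows "subgroup (R x) Aut_grp" "R x \<subseteq> G" "fidx (R x) K" "fidx (R x) G"
proof -
  note Dd = subgroup_Aut_grpD[OF D(1)]
  show sub: "subgroup (R x) Aut_grp"
    unfolding R_def
    by (rule subgroup_Aut_grpI)
      (use Kd Dd in \<open>auto simp: spread_comp ainv_spread[symmetric]\<close>)
  show "R x \<subseteq> G" using K(2) by (auto simp: R_def)
  show "fidx (R x) K"
    unfolding R_def
  proof (rule fidx_preimage[OF D(3,1) Gd(1)])
    show "spread x a \<in> G" if "a \<in> K" for a using spread_K[OF that] K(2) by blast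
    show "spread x (a \<circ> ainv b) = spread x a \<circ> ainv (spread x b)" if "a \<in> K" "b \<in> K" for a b
      using Kd(1) that by (simp add: spread_comp ainv_spread)
    show "a \<circ> ainv b \<in> K" if "a \<in> K" "b \<in> K" for a b using that Kd by blast
  qed
  then show "fidx (R x) G" using fidx_trans K sub G by blast
qed

text \<open>An element moving \<open>z\<close> cannot commute with a nontrivial element supported
  below \<open>z\<close>, because it carries that support elsewhere. Finite index provides such an
  element in \<open>M\<close>.\<close>

lemma fidx_nonabelian:
  assumes M: "subgroup M Aut_grp" "M \<subseteq> G" "fidx M G"
  obtains a b where "a \<in> M" "b \<in> M" "a \<circ> b \<noteq> b \<circ> a"
proof -
  note Md = subgroup_Aut_grpD[OF M(1)]
  have "infinite M" using fidx_infinite[OF M(3) infinite_G Gd(1)] by blast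
  then have "M \<noteq> {id}" by auto
  then obtain a where a: "a \<in> M" "a \<noteq> id" using Md(2) by blast
  then obtain z where z: "a z \<noteq> z" by (auto simp: fun_eq_iff)
  have "infinite {k \<in> K. spread z k \<in> M}"
    using fidx_infinite[OF spread_preimage(3)[OF M] infinite_K Kd(1)] by blast
  then have "{k \<in> K. spread z k \<in> M} \<noteq> {id}" by (metis finite.emptyI finite.insertI)
  moreover have "id \<in> {k \<in> K. spread z k \<in> M}" using Kd(2) Md(2) by simp
  ultimately obtain k where k: "k \<in> K" "spread z k \<in> M" "k \<noteq> id" by blast
  then obtain w where w: "k w \<noteq> w" by (auto simp: fun_eq_iff)
  have ta: "is_tree_aut a" "is_tree_aut k" using a(1) k(1) Md(1) Kd(1) by auto
  have "a \<circ> spread z k \<noteq> spread z k \<circ> a"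
  proof
    assume "a \<circ> spread z k = spread z k \<circ> a"
    then have "(a \<circ> spread z k) (z @ w) = (spread z k \<circ> a) (z @ w)" by simp
    moreover have "\<not> prefix z (a (z @ w))"
      using z ta by (auto simp: tree_aut_append prefix_def)
    ultimately have "a (z @ k w) = a (z @ w)" by (simp add: spread_other)
    then show False using w ta by (simp add: tree_aut_eq_iff)
  qed
  then show ?thesis using that a k by blast
qed

text \<open>The double commutator trick: if \<open>g\<close> moves \<open>x\<close>, then conjugating by \<open>g\<close> moves the support of
  \<open>spread x a\<close> off the subtree of \<open>x\<close>, and \<open>[[g, spread x a\<^sup>-\<^sup>1], spread x b]\<close> collapses to
  \<open>spread x [a, b]\<close>.\<close>

lemma normal_contains_spread:
  assumes D: "subgroup D Aut_grp" "D \<subseteq> G" "fidx D G"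
    and N: "subgroup N Aut_grp" "\<And>d n. d \<in> D \<Longrightarrow> n \<in> N \<Longrightarrow> d \<circ> n \<circ> ainv d \<in> N"
    and g: "g \<in> N" "g x \<noteq> x"
  obtains M where "subgroup M Aut_grp" "M \<subseteq> G" "fidx M G" "spread x ` M \<subseteq> N"
proof -
  note Dd = subgroup_Aut_grpD[OF D(1)] and Nd = subgroup_Aut_grpD[OF N(1)]
  \<comment> \<open>The core is normal in all of \<open>G\<close>, so its commutator subgroup is too
    and just infiniteness applies to it. Moreover its copy below \<open>x\<close> stays in
    \<open>D\<close>, which normalizes \<open>N\<close>.\<close>
  obtain M where M: "subgroup M Aut_grp" "M \<subseteq> {k \<in> K. spread x k \<in> D}" "fidx M G"
    "\<And>g n. g \<in> G \<Longrightarrow> n \<in> M \<Longrightarrow> g \<circ> n \<circ> ainv g \<in> M"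
    by (rule fidx_core[OF G spread_preimage(1,2,4)[OF D]]) blast
  note Md = subgroup_Aut_grpD[OF M(1)]
  let ?C = "{a \<circ> b \<circ> ainv a \<circ> ainv b | a b. a \<in> M \<and> b \<in> M}"
  let ?M' = "generate Aut_grp ?C"
  have CM: "?C \<subseteq> M" using Md(3,4) by blast
  have MG: "M \<subseteq> G" using M(2) K(2) by blast
  have ta: "\<And>c. c \<in> ?C \<Longrightarrow> is_tree_aut c" using CM Md(1) by blast
  have sub: "subgroup ?M' Aut_grp" by (rule generate_Aut_grp_subgroup) (rule ta)
  note M'd = subgroup_Aut_grpD[OF sub]
  have M'M: "?M' \<subseteq> M" using generate_Aut_grp_subset[OF M(1) CM] .
  have normal: "h \<circ> n \<circ> ainv h \<in> ?M'" if h: "h \<in> G" and n: "n \<in> ?M'" for h n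
    using n
  proof (induction rule: generate_Aut_grp_induct)
    case (aut s)
    then show ?case by (rule ta)
  next
    have hC: "h \<circ> c \<circ> ainv h \<in> ?C" if c: "c \<in> ?C" for c
    proof -
      obtain a b where ab: "a \<in> M" "b \<in> M" "c = a \<circ> b \<circ> ainv a \<circ> ainv b" using c by blast
      let ?a = "h \<circ> a \<circ> ainv h" and ?b = "h \<circ> b \<circ> ainv h"
      have "?a \<in> M" "?b \<in> M" using M(4) h ab by auto
      moreover have "h \<circ> c \<circ> ainv h = ?a \<circ> ?b \<circ> ainv ?a \<circ> ainv ?b"
        using ab(3) Gd(1)[OF h] Md(1)[OF ab(1)] Md(1)[OF ab(2)]
        by (simp add: ainv_comp fun_eq_iff)
      ultimately show ?thesis by blast
    qed
    {
      case (incl s)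
      then show ?case by (intro generate.incl hC)
    next
      case (inv s)
      have eq: "h \<circ> ainv s \<circ> ainv h = ainv (h \<circ> s \<circ> ainv h)"
        using ta[OF inv] Gd(1)[OF h] by (simp add: ainv_comp comp_assoc)
      show ?case unfolding eq by (intro M'd(4) generate.incl hC inv)
    }
  next
    case id
    have "h \<circ> id \<circ> ainv h = id" using Gd(1)[OF h] by simp
    then show ?case using M'd(2) by metis
  next
    case (comp a b)
    have "(h \<circ> a \<circ> ainv h) \<circ> (h \<circ> b \<circ> ainv h) = h \<circ> (a \<circ> b) \<circ> ainv h"
      using Gd(1)[OF h] by (simp add: fun_eq_iff)
    then show ?case using M'd(3)[OF comp(3,4)] by metis
  qed
  have "?M' \<noteq> {id}"
  proof -
    obtain a b where ab: "a \<in> M" "b \<in> M" "a \<circ> b \<noteq> b \<circ> a"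
      using fidx_nonabelian[OF M(1) MG M(3)] by blast
    let ?c = "a \<circ> b \<circ> ainv a \<circ> ainv b"
    have "?c \<circ> (b \<circ> a) = a \<circ> b" using Md(1)[OF ab(1)] Md(1)[OF ab(2)] by (simp add: fun_eq_iff)
    then have "?c \<noteq> id" using ab(3) by auto
    moreover have "?c \<in> ?M'" using ab by (intro generate.incl) blast
    ultimately show ?thesis by blast
  qed
  then have "fidx ?M' G" using quotients[OF sub _ normal] M'M MG by blast
  moreover have "spread x n \<in> N" if "n \<in> ?M'" for n
    using that
  proof (induction rule: generate_Aut_grp_induct)
    case (aut s)
    then show ?case by (rule ta)
  next
    have xC: "spread x c \<in> N" if c: "c \<in> ?C" for c
    proof -
      obtain a b where ab: "a \<in> M" "b \<in> M" "c = a \<circ> b \<circ> ainv a \<circ> ainv b" using c by blast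
      have t: "is_tree_aut a" "is_tree_aut b" "is_tree_aut g"
        using ab Md(1) g Nd(1) by auto
      define p where "p = spread x (ainv a)"
      define q where "q = spread x b"
      have pq: "p \<in> D" "q \<in> D" "is_tree_aut p" "is_tree_aut q"
        using ab M(2) Md(4) t by (auto simp: p_def q_def)
      \<comment> \<open>Only conjugation by \<open>D\<close> is known to preserve \<open>N\<close>,
        so both commutators are grouped as an element of \<open>N\<close> times a
        \<open>D\<close>-conjugate of its inverse.\<close>
      define e where "e = g \<circ> (p \<circ> ainv g \<circ> ainv p)"
      have eN: "e \<in> N" unfolding e_def using Nd(3) g(1) N(2)[OF pq(1) Nd(4)[OF g(1)]] by blast
      then have "e \<circ> (q \<circ> ainv e \<circ> ainv q) \<in> N" using Nd(3) N(2)[OF pq(2) Nd(4)[OF eN]] by blast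
      moreover have "e \<circ> (q \<circ> ainv e \<circ> ainv q) = spread x c"
      proof -
        \<comment> \<open>This conjugate lives below \<open>g x\<close>, away from the subtree of
          \<open>x\<close>, and therefore cancels in the second commutator.\<close>
        define p' where "p' = g \<circ> p \<circ> ainv g"
        have p': "is_tree_aut p'" "p' = spread (g x) (sect g x \<circ> ainv a \<circ> ainv (sect g x))"
          unfolding p'_def using t pq by (auto simp: p_def spread_conj)
        have comm: "p' \<circ> spread x k = spread x k \<circ> p'" if "is_tree_aut k" for k
          unfolding p'(2) by (rule spread_commute) (use t g that in auto)
        have e: "e = p' \<circ> ainv p" by (simp add: e_def p'_def comp_assoc)
        have "e \<circ> (q \<circ> ainv e \<circ> ainv q) = p' \<circ> (ainv p \<circ> q \<circ> p) \<circ> ainv p' \<circ> ainv q"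
          unfolding e using pq p'(1) by (simp add: ainv_comp comp_assoc)
        also have "ainv p \<circ> q \<circ> p = spread x (a \<circ> b \<circ> ainv a)"
          using t by (simp add: p_def q_def ainv_spread spread_comp)
        also have "p' \<circ> spread x (a \<circ> b \<circ> ainv a) \<circ> ainv p' = spread x (a \<circ> b \<circ> ainv a)"
          using comm[of "a \<circ> b \<circ> ainv a"] t p'(1) by (simp add: comp_assoc)
        also have "spread x (a \<circ> b \<circ> ainv a) \<circ> ainv q = spread x c"
          using t by (simp add: q_def ainv_spread spread_comp[symmetric] ab(3))
        finally show ?thesis .
      qed
      ultimately show ?thesis by simp
    qed
    {
      case (incl s)
      then show ?case by (rule xC)
    next
      case (inv s)
      then show ?case using Nd(4)[OF xC[OF inv]] ta[OF inv] by (simp add: ainv_spread)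
    }
  next
    case id
    then show ?case using Nd(2) spread_id by metis
  next
    case (comp a b)
    then show ?case using Nd(3) spread_comp by metis
  qed
  ultimately show ?thesis using that[of ?M'] sub M'M MG by blast
qed

text \<open>On a suitable level, \<open>N\<close> either moves a vertex, and then contains a copy of
  a finite index subgroup below it, or has trivial sections there. Hence the sections of its level
  stabilizer are finitely generated vertex by vertex.\<close>

lemma normal_in_fidx_fin_gen:
  assumes D: "subgroup D Aut_grp" "D \<subseteq> G" "fidx D G"
    and N: "subgroup N Aut_grp" "N \<subseteq> G" "\<And>d n. d \<in> D \<Longrightarrow> n \<in> N \<Longrightarrow> d \<circ> n \<circ> ainv d \<in> N"
  shows "fin_gen N"
proof -
  note Dd = subgroup_Aut_grpD[OF D(1)] and Nd = subgroup_Aut_grpD[OF N(1)]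
  obtain m where m: "\<And>u v. m \<le> length u \<Longrightarrow> length u = length v \<Longrightarrow> take m u = take m v \<Longrightarrow> \<exists>d\<in>D. d u = v"
    using fidx_orbits_stabilize[OF G transitive D] by blast
  \<comment> \<open>If \<open>N\<close> moves something below \<open>v\<close>, then
    \<open>pick v\<close> is such a vertex, and \<open>n\<close> is at least the length of all of
    these for \<open>v\<close> on level \<open>m\<close>. Where nothing is moved,
    \<open>pick v\<close> is arbitrary and can only enlarge \<open>n\<close>.\<close>
  define moved where "moved v x \<longleftrightarrow> prefix v x \<and> (\<exists>g\<in>N. g x \<noteq> x)" for v x
  define pick where "pick v = (SOME x. moved v x)" for v
  have pick: "moved v (pick v)" if "moved v x" for v x
    using that unfolding pick_def by (rule someI)
  define n where "n = Max (insert m ((\<lambda>v. length (pick v)) ` level m))"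
  have n: "m \<le> n" "\<And>v. v \<in> level m \<Longrightarrow> length (pick v) \<le> n"
    unfolding n_def using finite_level by (auto intro!: Max_ge)
  have dich: "(\<exists>g\<in>N. g u \<noteq> u) \<or> (\<forall>g\<in>N. sect g u = id)" if u: "u \<in> level n" for u
  proof (cases "\<exists>x. moved (take m u) x")
    case True
    let ?v = "take m u"
    have v: "?v \<in> level m" using u n(1) by (auto simp: level_def)
    \<comment> \<open>Extended to level \<open>n\<close>, the picked vertex is still moved. It
      agrees with \<open>u\<close> up to level \<open>m\<close>, so some \<open>d\<close> in
      \<open>D\<close> takes it to \<open>u\<close>, and conjugation by \<open>d\<close> transports
      the motion.\<close>
    let ?x = "pick ?v" and ?x' = "pick ?v @ replicate (n - length (pick ?v)) undefined"
    obtain g where g: "g \<in> N" "g ?x \<noteq> ?x" and pre: "prefix ?v ?x"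
      using True pick unfolding moved_def by blast
    have tg: "is_tree_aut g" using g(1) Nd(1) by blast
    have gx': "g ?x' \<noteq> ?x'" using g(2) tg by (auto simp: tree_aut_append)
    have len: "length ?x' = n" using n(2)[OF v] by simp
    have "take m ?x' = ?v" using pre v by (auto simp: prefix_def level_def)
    then obtain d where d: "d \<in> D" "d ?x' = u" using m[of ?x' u] len u n(1) by (auto simp: level_def)
    have td: "is_tree_aut d" using d(1) Dd(1) by blast
    have "(d \<circ> g \<circ> ainv d) (d x) \<noteq> d x" if "g x \<noteq> x" for x
      using that td by (simp add: tree_aut_eq_iff)
    from this[OF gx'] have "(d \<circ> g \<circ> ainv d) u \<noteq> u" by (metis d(2))
    then show ?thesis using N(3)[OF d(1) g(1)] by blast
  next
    case False
    have "sect g u = id" if g: "g \<in> N" for g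
    proof
      fix w
      have "prefix (take m u) (u @ w)" "prefix (take m u) u"
        by (auto simp: take_is_prefix prefix_prefix)
      then have "g (u @ w) = u @ w" "g u = u" using False g unfolding moved_def by blast+
      then show "sect g u w = id w" by (simp add: sect_def)
    qed
    then show ?thesis by blast
  qed
  let ?E = "stab_set N (level n)"
  have E: "subgroup ?E Aut_grp" using N(1) by (rule stab_set_subgroup)
  have "fin_gen ?E"
  proof (rule fin_gen_via_sections[OF E finite_level spanning_level])
    show "e y = y" if "e \<in> ?E" "y \<in> level n" for e y using that by (auto simp: stab_set_def)
    fix Z :: "'a list set" and y :: "'a list" assume Zy: "Z \<subseteq> level n" "y \<in> level n"
    let ?F = "{e \<in> ?E. \<forall>z\<in>Z. sect e z = id}"
    have F: "subgroup ?F Aut_grp"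
      using E by (rule sect_id_subgroup) (use Zy(1) in \<open>auto simp: stab_set_def\<close>)
    note Fd = subgroup_Aut_grpD[OF F]
    have P: "subgroup (psi y ?F) Aut_grp"
      using F by (rule psi_subgroup) (use Zy(2) in \<open>auto simp: stab_set_def\<close>)
    show "fin_gen (psi y ?F)"
    proof (cases "(\<forall>g\<in>N. sect g y = id) \<or> y \<in> Z")
      case True
      then have "psi y ?F \<subseteq> {id}" by (auto simp: psi_def stab_set_def)
      then have "psi y ?F = {id}" using subgroup_Aut_grpD(2)[OF P] by blast
      then show ?thesis using fin_gen_trivial by metis
    next
      case False
      then obtain g where g: "g \<in> N" "g y \<noteq> y" using dich[OF Zy(2)] by blast
      obtain M where M: "subgroup M Aut_grp" "M \<subseteq> G" "fidx M G" "spread y ` M \<subseteq> N"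
        using normal_contains_spread[OF D N(1,3) g] by blast
      \<comment> \<open>Elements supported below \<open>y\<close> fix level \<open>n\<close> and
        have trivial sections at its other vertices; as \<open>y\<close> is not in \<open>Z\<close>,
        the copy of \<open>M\<close> meets all conditions of \<open>?F\<close>.\<close>
      have "M \<subseteq> psi y ?F"
      proof
        fix k assume k: "k \<in> M"
        then have tk: "is_tree_aut k" using subgroup_Aut_grpD(1)[OF M(1)] by blast
        have "spread y k v = v" if "v \<in> level n" for v
        proof (cases "v = y")
          case False
          then have "\<not> prefix y v" using that Zy(2) by (auto simp: level_def prefix_def)
          then show ?thesis by (rule spread_other)
        qed (simp add: tk spread_self)
        moreover have "sect (spread y k) z = id" if "z \<in> Z" for z
          by (rule sect_spread_other) (use that Zy False in \<open>auto simp: level_def\<close>)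
        ultimately have "spread y k \<in> ?F" using k M(4) by (auto simp: stab_set_def)
        then show "k \<in> psi y ?F" unfolding psi_def
          by (rule rev_image_eqI) (simp add: tk)
      qed
      then have "fidx (psi y ?F) G" using M(3) fidx_mono by blast
      moreover have "psi y ?F \<subseteq> G"
        using N(2) self_similar by (auto simp: psi_def stab_set_def)
      ultimately show ?thesis using schreier_fin_gen[OF fin_gen_G G P] by blast
    qed
  qed
  moreover have "fidx ?E N" using fidx_stab_set[OF N(1) finite_level] .
  moreover have "?E \<subseteq> N" by (auto simp: stab_set_def)
  ultimately show ?thesis using fin_gen_fidx_overgroup[OF _ N(1) E] by blast
qed

text \<open>Killing the sections at some vertices leaves a normal subgroup of the stabilizer. Its
  sections at \<open>y\<close> are normalized by the finite index subgroup
  \<open>psi y (stab_set B Y)\<close>, so \<open>normal_in_fidx_fin_gen\<close> applies to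
  them.\<close>

lemma infra_direct_fin_gen:
  assumes B: "subgroup B Aut_grp" "B \<subseteq> G" and Y: "finite Y" "spanning Y"
    and ind: "\<And>y. y \<in> Y \<Longrightarrow> fidx (psi y (stab_set B Y)) G"
  shows "fin_gen B"
proof -
  let ?E = "stab_set B Y"
  have E: "subgroup ?E Aut_grp" using B(1) by (rule stab_set_subgroup)
  note Ed = subgroup_Aut_grpD[OF E]
  have Efix: "\<And>e y. e \<in> ?E \<Longrightarrow> y \<in> Y \<Longrightarrow> e y = y" by (auto simp: stab_set_def)
  have EG: "psi y C \<subseteq> G" if "C \<subseteq> ?E" for y C
    using that B(2) self_similar by (auto simp: psi_def stab_set_def)
  have "fin_gen ?E"
  proof (rule fin_gen_via_sections[OF E Y])
    show "e y = y" if "e \<in> ?E" "y \<in> Y" for e y using Efix that .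
    fix Z y assume Zy: "Z \<subseteq> Y" "y \<in> Y"
    let ?F = "{e \<in> ?E. \<forall>z\<in>Z. sect e z = id}"
    have F: "subgroup ?F Aut_grp"
      using E by (rule sect_id_subgroup) (use Zy(1) Efix in auto)
    have PF: "subgroup (psi y ?F) Aut_grp" using F by (rule psi_subgroup) (use Zy(2) Efix in auto)
    have PE: "subgroup (psi y ?E) Aut_grp" using E by (rule psi_subgroup) (use Zy(2) Efix in auto)
    show "fin_gen (psi y ?F)"
    proof (rule normal_in_fidx_fin_gen[OF PE EG[OF order_refl] ind[OF Zy(2)] PF])
      show "psi y ?F \<subseteq> G" by (rule EG) auto
      fix d n assume "d \<in> psi y ?E" "n \<in> psi y ?F"
      then obtain a f where af: "a \<in> ?E" "d = sect a y" "f \<in> ?F" "n = sect f y"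
        unfolding psi_def by blast
      have t: "is_tree_aut a" "is_tree_aut f" using af Ed(1) by auto
      have fixed: "ainv a z = z" "f z = z" "a z = z" if "z \<in> Y" for z
        using that af Efix t(1) by (auto simp: ainv_fix)
      have sect_conj: "sect (a \<circ> f \<circ> ainv a) z = sect a z \<circ> sect f z \<circ> ainv (sect a z)"
        if "z \<in> Y" for z
        using fixed[OF that] t by (simp add: sect_comp sect_ainv_fix)
      have "sect (a \<circ> f \<circ> ainv a) z = id" if "z \<in> Z" for z
        using sect_conj[of z] that Zy(1) af(3) t by auto
      moreover have "a \<circ> f \<circ> ainv a \<in> ?E" using af Ed(3,4) by blast
      ultimately have "a \<circ> f \<circ> ainv a \<in> ?F" by blast
      then show "d \<circ> n \<circ> ainv d \<in> psi y ?F"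
        unfolding psi_def af sect_conj[OF Zy(2), symmetric] by blast
    qed
  qed
  moreover have "fidx ?E B" using fidx_stab_set[OF B(1) Y(1)] .
  moreover have "?E \<subseteq> B" by (auto simp: stab_set_def)
  ultimately show ?thesis using fin_gen_fidx_overgroup[OF _ B(1) E] by blast
qed

text \<open>An overgroup has a larger stabilizer with more sections, so their index stays
  finite.\<close>

lemma infra_direct_overgroup_fin_gen:
  assumes "leaf_set Y" "spanning Y" "infra_direct G H Y"
    and L: "subgroup L Aut_grp" "L \<subseteq> G" "H \<subseteq> L"
  shows "fin_gen L"
proof (rule infra_direct_fin_gen[OF L(1,2) _ assms(2)])
  show "finite Y" using assms(1) by (simp add: leaf_set_def)
  fix y assume "y \<in> Y"
  then have "fidx (psi y (stab_set H Y)) G"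
    using assms(3) fin_index_iff[OF G] by (simp add: infra_direct_def)
  moreover have "psi y (stab_set H Y) \<subseteq> psi y (stab_set L Y)"
    using L(3) by (auto simp: psi_def stab_set_def)
  ultimately show "fidx (psi y (stab_set L Y)) G" by (rule fidx_mono)
qed

text \<open>A nontrivial automorphism preserves length, so it changes some letter. The bound makes
  levels grow exponentially, which \<open>finite_sections_perturb\<close> exploits.\<close>

lemma two_le_card_alphabet: "2 \<le> CARD('a)"
proof -
  have "G \<noteq> {id}" using infinite_G by auto
  then obtain g where g: "g \<in> G" "g \<noteq> id" using Gd(2) by blast
  then obtain x where x: "g x \<noteq> x" by (auto simp: fun_eq_iff)
  have "length (g x) = length x" using Gd(1)[OF g(1)] by simp
  then obtain i where "i < length x" "g x ! i \<noteq> x ! i" using x by (metis nth_equalityI)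
  then have "card {g x ! i, x ! i} = 2" by simp
  moreover have "card {g x ! i, x ! i} \<le> CARD('a)" by (intro card_mono) auto
  ultimately show ?thesis by simp
qed

section \<open>Level stabilizers and small perturbations of subgroups\<close>

lemma stab_level_mono:
  assumes "n \<le> m"
  shows "stab_level G m \<subseteq> stab_level G n"
proof
  fix g assume g: "g \<in> stab_level G m"
  then have tg: "g \<in> G" "is_tree_aut g" using Gd(1) by (auto simp: stab_level_def stab_set_def)
  have "g v = v" if "length v = n" for v
  proof -
    have "g (v @ replicate (m - n) undefined) = v @ replicate (m - n) undefined"
      using g that assms by (auto simp: stab_level_def stab_set_def level_def)
    then show ?thesis using tg(2) by (simp add: tree_aut_append)
  qed
  then show "g \<in> stab_level G n" using tg(1) by (auto simp: stab_level_def stab_set_def level_def)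
qed

text \<open>The level stabilizer is normal in \<open>G\<close>, so its factors can be collected on
  the right.\<close>

lemma mult_stab_level_subgroup:
  assumes H: "subgroup H Aut_grp" "H \<subseteq> G"
  shows "subgroup {h \<circ> k | h k. h \<in> H \<and> k \<in> stab_level G n} Aut_grp" (is "subgroup ?Q _")
proof -
  note Hd = subgroup_Aut_grpD[OF H(1)]
  have S: "subgroup (stab_level G n) Aut_grp"
    unfolding stab_level_def using G by (rule stab_set_subgroup)
  note Sd = subgroup_Aut_grpD[OF S]
  have conj: "g \<circ> k \<circ> ainv g \<in> stab_level G n" if g: "g \<in> G" and k: "k \<in> stab_level G n" for g k
  proof -
    have t: "is_tree_aut g" using g Gd(1) by blast
    have "g (k (ainv g v)) = v" if "length v = n" for v
      using k t that by (simp add: stab_level_def stab_set_def level_def)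
    moreover have "g \<circ> k \<circ> ainv g \<in> G" using g k Gd(3,4) by (auto simp: stab_level_def stab_set_def)
    ultimately show ?thesis by (simp add: stab_level_def stab_set_def level_def)
  qed
  show ?thesis
  proof (rule subgroup_Aut_grpI)
    show "id \<in> ?Q" using Hd(2) Sd(2) by (auto intro!: exI[of _ id])
    fix a assume "a \<in> ?Q"
    then obtain h k where a: "a = h \<circ> k" "h \<in> H" "k \<in> stab_level G n" by blast
    have t: "is_tree_aut h" "is_tree_aut k" using a Hd(1) Sd(1) by auto
    then show "is_tree_aut a" using a by simp
    have "ainv a = ainv h \<circ> (h \<circ> ainv k \<circ> ainv h)"
      unfolding a(1) using t by (simp add: ainv_comp fun_eq_iff)
    moreover have "h \<circ> ainv k \<circ> ainv h \<in> stab_level G n" using conj a H(2) Sd(4) by blast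
    ultimately show "ainv a \<in> ?Q" using Hd(4)[OF a(2)] by blast
    fix b assume "b \<in> ?Q"
    then obtain h' k' where b: "b = h' \<circ> k'" "h' \<in> H" "k' \<in> stab_level G n" by blast
    have t': "is_tree_aut h'" using b Hd(1) by blast
    have "ainv h' \<circ> k \<circ> ainv (ainv h') \<in> stab_level G n" using conj[of "ainv h'"] a b H(2) Hd(4) by blast
    then have "ainv h' \<circ> k \<circ> h' \<in> stab_level G n" using t' by simp
    then have "ainv h' \<circ> k \<circ> h' \<circ> k' \<in> stab_level G n" using Sd(3) b(3) by blast
    moreover have "a \<circ> b = (h \<circ> h') \<circ> (ainv h' \<circ> k \<circ> h' \<circ> k')"
      using t' a b by (simp add: fun_eq_iff)
    ultimately show "a \<circ> b \<in> ?Q" using Hd(3)[OF a(2) b(2)] by blast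
  qed
qed

text \<open>Adjoining to \<open>H\<close> a copy of \<open>K\<close> below a deep vertex \<open>u\<close> does not affect the sections at a
  vertex \<open>z\<close> of the same level outside the \<open>H\<close>-orbit of \<open>u\<close>; such a \<open>z\<close> exists because \<open>H\<close> acts
  below \<open>y\<close> through finitely many sections.\<close>

lemma finite_sections_perturb:
  assumes H: "subgroup H Aut_grp" "H \<subseteq> G" and fin: "finite (psi y H)"
  obtains L z where "subgroup L Aut_grp" "H \<subseteq> L" "L \<noteq> H" "finite (psi z L)"
    "L \<subseteq> {h \<circ> k | h k. h \<in> H \<and> k \<in> stab_level G n}"
proof -
  note Hd = subgroup_Aut_grpD[OF H(1)]
  \<comment> \<open>Depth at least \<open>n\<close> puts the new elements into the level stabilizer.
    The second summand makes \<open>2 ^ j\<close> exceed the number of sections, so their values at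
    \<open>w0\<close> miss a word of length \<open>j\<close>.\<close>
  define j where "j = n + card (psi y H)"
  define w0 :: "'a list" where "w0 = replicate j undefined"
  define u where "u = y @ w0"
  have "card ((\<lambda>s. s w0) ` psi y H) \<le> card (psi y H)" using fin by (rule card_image_le)
  also have "\<dots> \<le> j" by (simp add: j_def)
  also have "\<dots> < 2 ^ j" by (rule less_exp)
  also have "\<dots> \<le> CARD('a) ^ j" using two_le_card_alphabet by (rule power_mono) simp
  also have "\<dots> = card (level j :: 'a list set)"
    using card_lists_length_eq[of "UNIV :: 'a set" j] by (simp add: level_def)
  finally have "\<not> level j \<subseteq> (\<lambda>s. s w0) ` psi y H"
    using card_mono[of "(\<lambda>s. s w0) ` psi y H" "level j"] fin by auto
  then obtain w where w: "length w = j" "w \<notin> (\<lambda>s. s w0) ` psi y H" by (auto simp: level_def)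
  define z where "z = y @ w"
  have lenuz: "length u = length z" "n \<le> length u" using w by (auto simp: u_def z_def w0_def j_def)
  have hu: "h u \<noteq> z" if "h \<in> H" for h
  proof
    assume "h u = z"
    then have "sect h y w0 = w"
      using Hd(1)[OF that] by (simp add: u_def z_def tree_aut_append)
    then show False using w(2) that by (auto simp: psi_def)
  qed
  have hz: "h z \<noteq> u" if "h \<in> H" for h
    using hu[OF Hd(4)[OF that]] Hd(1)[OF that] by (metis tree_aut_ainv_left)
  define S where "S = H \<union> spread u ` K"
  define L where "L = generate Aut_grp S"
  have tS: "\<And>s. s \<in> S \<Longrightarrow> is_tree_aut s" using Hd(1) Kd(1) by (auto simp: S_def)
  have L: "subgroup L Aut_grp" unfolding L_def by (rule generate_Aut_grp_subgroup) (rule tS)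
  have SL: "S \<subseteq> L" unfolding L_def by (auto intro: generate.incl)
  have "L \<noteq> H"
  proof
    assume "L = H"
    then have "spread u k \<in> H" if "k \<in> K" for k using SL that by (auto simp: S_def)
    then have "K \<subseteq> psi u H" unfolding psi_def
      using Kd(1) by (auto intro!: rev_image_eqI[of "spread u _"])
    moreover have "finite (psi u H)" unfolding u_def using fin H(1) by (rule finite_psi_append)
    ultimately show False using infinite_K finite_subset by blast
  qed
  moreover have "finite (psi z L)"
  proof -
    \<comment> \<open>The claim covers the whole \<open>H\<close>-orbit of \<open>z\<close> in order
      to survive composition. Below that orbit each generator acts like an element of
      \<open>H\<close>, since \<open>u\<close> is not in it.\<close>
    have "\<forall>h\<in>H. \<exists>h'\<in>H. \<forall>v. a (h z @ v) = h' (h z @ v)" if "a \<in> L" for a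
      using that unfolding L_def
    proof (induction rule: generate_Aut_grp_induct)
      case (aut s)
      then show ?case by (rule tS)
    next
      have not_pre: "\<not> prefix u (h z @ v)" if "h \<in> H" for h v
        using hz[OF that] lenuz(1) Hd(1)[OF that] by (auto simp: prefix_def)
      have K_case: "\<exists>h'\<in>H. \<forall>v. spread u k (h z @ v) = h' (h z @ v)" if "h \<in> H" for h k
        using not_pre[OF that] Hd(2) by (intro bexI[of _ id]) (auto simp: spread_other)
      {
        case (incl s)
        then show ?case unfolding S_def using K_case by blast
      next
        case (inv s)
        then consider "ainv s \<in> H" | k where "ainv s = spread u k"
          unfolding S_def using Hd(4) ainv_spread Kd(1) by blast
        then show ?case using K_case by cases (blast, metis)
      }
    next
      case id
      then show ?case using Hd(2) by blast
    next
      case (comp a b)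
      show ?case
      proof
        fix h assume h: "h \<in> H"
        obtain h1 where h1: "h1 \<in> H" "\<And>v. b (h z @ v) = h1 (h z @ v)" using comp(4) h by blast
        have hh: "h1 \<circ> h \<in> H" using h h1 Hd(3) by blast
        obtain h2 where h2: "h2 \<in> H" "\<And>v. a ((h1 \<circ> h) z @ v) = h2 ((h1 \<circ> h) z @ v)"
          using comp(3) hh by blast
        have "(a \<circ> b) (h z @ v) = (h2 \<circ> h1) (h z @ v)" for v
          using h1(2)[of v] h2(2) Hd(1)[OF h1(1)] by (simp add: tree_aut_append)
        then show "\<exists>h'\<in>H. \<forall>v. (a \<circ> b) (h z @ v) = h' (h z @ v)"
          using Hd(3)[OF h2(1) h1(1)] by blast
      qed
    qed
    then have agree: "\<exists>h'\<in>H. \<forall>v. a (z @ v) = h' (z @ v)" if "a \<in> L" for a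
      using that Hd(2) by fastforce
    have "psi z L \<subseteq> psi z H"
    proof
      fix s assume "s \<in> psi z L"
      then obtain a where a: "a \<in> L" "s = sect a z" by (auto simp: psi_def)
      obtain h' where h': "h' \<in> H" "\<And>v. a (z @ v) = h' (z @ v)" using agree[OF a(1)] by blast
      have "s = sect h' z" unfolding a(2) sect_def using h'(2) h'(2)[of "[]"] by simp
      then show "s \<in> psi z H" using h'(1) by (auto simp: psi_def)
    qed
    moreover have "finite (psi z H)" unfolding z_def using fin H(1) by (rule finite_psi_append)
    ultimately show ?thesis by (rule finite_subset)
  qed
  moreover have "L \<subseteq> {h \<circ> k | h k. h \<in> H \<and> k \<in> stab_level G n}" (is "_ \<subseteq> ?Q")
    unfolding L_def
  proof (rule generate_Aut_grp_subset[OF mult_stab_level_subgroup[OF H]])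
    have "h \<in> ?Q" if "h \<in> H" for h
    proof -
      have "id \<in> stab_level G n" using Gd(2) by (simp add: stab_level_def stab_set_def)
      moreover have "h = h \<circ> id" by simp
      ultimately show ?thesis using that by blast
    qed
    moreover have "spread u k \<in> ?Q" if k: "k \<in> K" for k
    proof -
      have "spread u k v = v" if "v \<in> level (length u)" for v
      proof (cases "v = u")
        case False
        then have "\<not> prefix u v" using that by (auto simp: level_def prefix_def)
        then show ?thesis by (rule spread_other)
      qed (simp add: Kd(1)[OF k] spread_self)
      then have "spread u k \<in> stab_level G (length u)"
        using spread_K[OF k] K(2) by (auto simp: stab_level_def stab_set_def)
      then have "spread u k \<in> stab_level G n" using stab_level_mono[OF lenuz(2)] by blast
      moreover have "spread u k = id \<circ> spread u k" by simp
      ultimately show ?thesis using Hd(2) by blast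
    qed
    ultimately show "S \<subseteq> ?Q" unfolding S_def by blast
  qed
  moreover have "H \<subseteq> L" using SL by (auto simp: S_def)
  ultimately show ?thesis using that L by blast
qed

end

subsection \<open>The perfect kernel\<close>

lemma cb_deriv_subset: "cb_deriv T A \<subseteq> A"
  by (simp add: cb_deriv_def)

lemma cb_deriv_mono: "A \<subseteq> B \<Longrightarrow> cb_deriv T A \<subseteq> cb_deriv T B"
  unfolding cb_deriv_def using derived_set_of_mono by blast

text \<open>The derivative is monotone and keeps every point of a set without isolated points, so
  such a set survives all stages.\<close>

lemma subset_cb_iterates:
  assumes "A \<in> cb_iterates T Z" "D \<subseteq> Z" "D \<subseteq> cb_deriv T D"
  shows "D \<subseteq> A"
  using assms(1)
proof induction
  case (succ A)
  then show ?case using assms(3) cb_deriv_mono by blast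
qed (use assms in auto)

lemma cb_iterates_subset: "A \<in> cb_iterates T Z \<Longrightarrow> A \<subseteq> Z"
proof (induction rule: cb_iterates.induct)
  case (succ A)
  then show ?case using cb_deriv_subset[of T A] by simp
qed auto

text \<open>By the rule \<open>lim\<close> the intersection of all iterates is an iterate, so its
  derivative cannot be smaller. Hence the kernel is the largest subset of \<open>Z\<close> without
  isolated points.\<close>

lemma perfect_kernel_properties:
  shows "cb_deriv T (perfect_kernel T Z) = perfect_kernel T Z" "perfect_kernel T Z \<subseteq> Z"
    and "\<And>D. D \<subseteq> Z \<Longrightarrow> D \<subseteq> cb_deriv T D \<Longrightarrow> D \<subseteq> perfect_kernel T Z"
proof -
  let ?P = "\<Inter> (cb_iterates T Z)"
  have mem: "?P \<in> cb_iterates T Z"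
    by (rule cb_iterates.lim) (use cb_iterates.base in auto)
  have deriv: "cb_deriv T ?P = ?P"
    using Inter_lower[OF cb_iterates.succ[OF mem]] cb_deriv_subset[of T ?P] by (rule equalityI[rotated])
  \<comment> \<open>A fixed iterate has no isolated points and so lies in every iterate; this makes
    the definite description meaningful.\<close>
  have uniq: "Q = ?P" if "Q \<in> cb_iterates T Z" "cb_deriv T Q = Q" for Q
  proof
    show "Q \<subseteq> ?P" using subset_cb_iterates[OF mem cb_iterates_subset[OF that(1)]] that(2) by simp
    show "?P \<subseteq> Q" using that(1) by (rule Inter_lower)
  qed
  have eq: "perfect_kernel T Z = ?P"
    unfolding perfect_kernel_def using conjI[OF mem deriv]
    by (rule the_equality) (elim conjE, rule uniq)
  show "cb_deriv T (perfect_kernel T Z) = perfect_kernel T Z" "perfect_kernel T Z \<subseteq> Z"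
    unfolding eq by (fact deriv cb_iterates_subset[OF mem])+
  show "D \<subseteq> perfect_kernel T Z" if "D \<subseteq> Z" "D \<subseteq> cb_deriv T D" for D
    unfolding eq using subset_cb_iterates[OF mem that] .
qed

section \<open>The Chabauty topology on the subgroups\<close>

lemma topspace_chabauty: "topspace (chabauty G) = Sub G"
  by (auto simp: chabauty_def topspace_pullback_topology)

lemma openin_chabauty_supersets:
  assumes "finite F" "F \<subseteq> G"
  shows "openin (chabauty G) {L \<in> Sub G. F \<subseteq> L}"
proof -
  define W where "W g = (if g \<in> F then {True} else UNIV)" for g
  have fin: "finite {g. W g \<noteq> topspace (discrete_topology UNIV)}"
    by (rule finite_subset[OF _ assms(1)]) (auto simp: W_def)
  have "openin (product_topology (\<lambda>_. discrete_topology (UNIV :: bool set)) G) (Pi\<^sub>E G W)"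
    by (rule product_topology_basis[OF _ fin]) simp
  moreover have "{L \<in> Sub G. F \<subseteq> L} = (\<lambda>H. restrict (\<lambda>g. g \<in> H) G) -` (Pi\<^sub>E G W) \<inter> Sub G"
    using assms(2) by (auto simp: W_def PiE_iff split: if_splits)
  ultimately show ?thesis
    unfolding chabauty_def openin_pullback_topology by blast
qed

text \<open>\<open>F\<close> consists of the finitely many coordinates that a product box around
  \<open>H\<close> restricts.\<close>

lemma openin_chabauty_basis:
  assumes "openin (chabauty G) U" "H \<in> U"
  obtains F where "finite F" "F \<subseteq> G" "\<And>L. L \<in> Sub G \<Longrightarrow> L \<inter> F = H \<inter> F \<Longrightarrow> L \<in> U"
proof -
  let ?r = "\<lambda>H. restrict (\<lambda>g. g \<in> H) G"
  obtain V where V: "openin (product_topology (\<lambda>_. discrete_topology (UNIV :: bool set)) G) V"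
    "U = ?r -` V \<inter> Sub G"
    using assms(1) unfolding chabauty_def openin_pullback_topology by blast
  have "?r H \<in> V" using assms(2) V(2) by blast
  then obtain W where W: "?r H \<in> Pi\<^sub>E G W"
    "finite {g. W g \<noteq> topspace (discrete_topology (UNIV :: bool set))}" "Pi\<^sub>E G W \<subseteq> V"
    using product_topology_open_contains_basis[OF V(1)] by blast
  let ?F = "{g \<in> G. W g \<noteq> UNIV}"
  have "finite ?F" by (rule finite_subset[OF _ W(2)]) auto
  moreover have "L \<in> U" if L: "L \<in> Sub G" "L \<inter> ?F = H \<inter> ?F" for L
  proof -
    have "(g \<in> L) \<in> W g" if g: "g \<in> G" for g
    proof (cases "W g = UNIV")
      case False
      then have "(g \<in> L) = (g \<in> H)" using L(2) g by blast
      then show ?thesis using W(1) g by (auto simp: PiE_iff)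
    qed auto
    then have "?r L \<in> Pi\<^sub>E G W" by auto
    then show ?thesis using W(3) V(2) L(1) by blast
  qed
  ultimately show ?thesis using that[of ?F] by blast
qed

lemma in_cb_deriv_chabauty_iff:
  assumes "A \<subseteq> Sub G"
  shows "H \<in> cb_deriv (chabauty G) A \<longleftrightarrow>
    H \<in> A \<and> (\<forall>U. openin (chabauty G) U \<and> H \<in> U \<longrightarrow> (\<exists>L\<in>A \<inter> U. L \<noteq> H))"
proof (cases "H \<in> A")
  case True
  then have "H \<in> Sub G" using assms by (rule subsetD[rotated])
  with True show ?thesis
    unfolding cb_deriv_def Bex_def Int_iff in_derived_set_of topspace_chabauty by meson
qed (simp add: cb_deriv_def)

lemma Union_chain_subgroup:
  assumes "C \<noteq> {}" "\<And>L. L \<in> C \<Longrightarrow> subgroup L Aut_grp"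
    and chain: "\<And>L M. L \<in> C \<Longrightarrow> M \<in> C \<Longrightarrow> L \<subseteq> M \<or> M \<subseteq> L"
  shows "subgroup (\<Union>C) Aut_grp"
proof (rule subgroup_Aut_grpI)
  show "id \<in> \<Union>C" using assms(1,2) subgroup_Aut_grpD(2) by blast
  show "is_tree_aut a" "ainv a \<in> \<Union>C" if "a \<in> \<Union>C" for a
    using that assms(2) subgroup_Aut_grpD(1,4) by blast+
  show "a \<circ> b \<in> \<Union>C" if ab: "a \<in> \<Union>C" "b \<in> \<Union>C" for a b
  proof -
    obtain L M where "L \<in> C" "a \<in> L" "M \<in> C" "b \<in> M" using ab by blast
    then show ?thesis using chain[of L M] assms(2) subgroup_Aut_grpD(3) by blast
  qed
qed

lemma finite_subset_Union_chain:
  assumes "finite S" "S \<subseteq> \<Union>C" "C \<noteq> {}"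
    and chain: "\<And>L M. L \<in> C \<Longrightarrow> M \<in> C \<Longrightarrow> L \<subseteq> M \<or> M \<subseteq> L"
  shows "\<exists>L\<in>C. S \<subseteq> L"
  using assms(1,2)
proof induction
  case (insert s S)
  obtain L where "L \<in> C" "S \<subseteq> L" using insert.IH insert.prems by auto
  moreover obtain M where "M \<in> C" "s \<in> M" using insert.prems by auto
  ultimately show ?case using chain[of L M] by (metis insert_subset subsetD subset_trans)
qed (use assms(3) in auto)

text \<open>If all overgroups of \<open>H\<close> are finitely generated, they satisfy the ascending chain condition;
  a maximal overgroup in a set without isolated points would be isolated, since the overgroups of a
  finitely generated group form an open set.\<close>

lemma noetherian_overgroups_not_in_perfect:
  assumes G: "subgroup G Aut_grp" and H: "subgroup H Aut_grp" "H \<subseteq> G"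
    and P: "P \<subseteq> Sub G" "cb_deriv (chabauty G) P = P"
    and fg: "\<And>L. subgroup L Aut_grp \<Longrightarrow> L \<subseteq> G \<Longrightarrow> H \<subseteq> L \<Longrightarrow> fin_gen L"
  shows "H \<notin> P"
proof
  assume HP: "H \<in> P"
  have Sub: "L \<in> Sub G \<longleftrightarrow> subgroup L Aut_grp \<and> L \<subseteq> G" for L
    using subgroup_grp_iff[OF G] by (simp add: Sub_def)
  let ?A = "{L \<in> P. H \<subseteq> L}"
  have "\<exists>M\<in>?A. \<forall>N\<in>?A. M \<subseteq> N \<longrightarrow> N = M"
  proof (rule subset_Zorn_nonempty)
    show "?A \<noteq> {}" using HP by blast
    fix C assume C: "C \<noteq> {}" "subset.chain ?A C"
    have CA: "C \<subseteq> ?A" using C(2) by (simp add: subset.chain_def)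
    have chain: "L \<subseteq> M \<or> M \<subseteq> L" if "L \<in> C" "M \<in> C" for L M
      using C(2) that by (auto simp: subset_chain_def)
    have subC: "subgroup L Aut_grp" "L \<subseteq> G" if "L \<in> C" for L
      using CA that P(1) Sub by blast+
    have U: "subgroup (\<Union>C) Aut_grp" "\<Union>C \<subseteq> G" "H \<subseteq> \<Union>C"
      using Union_chain_subgroup[OF C(1) subC(1) chain] subC(2) C(1) CA by blast+
    \<comment> \<open>The union is an overgroup of \<open>H\<close>, hence finitely generated. Its
      generators already lie in one member of the chain, which is then the whole union.\<close>
    obtain S where S: "finite S" "S \<subseteq> \<Union>C" "generate Aut_grp S = \<Union>C"
      using fg[OF U] by (auto simp: fin_gen_def)
    obtain L where L: "L \<in> C" "S \<subseteq> L"
      using finite_subset_Union_chain[OF S(1,2) C(1) chain] by blast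
    then have "\<Union>C \<subseteq> L" using generate_Aut_grp_subset[OF subC(1)[OF L(1)] L(2)] S(3) by simp
    then have "\<Union>C = L" using L(1) by blast
    then show "\<Union>C \<in> ?A" using L(1) CA by blast
  qed
  then obtain M where MA: "M \<in> ?A" "\<forall>N\<in>?A. M \<subseteq> N \<longrightarrow> N = M" by (rule bexE)
  then have M: "M \<in> P" "H \<subseteq> M" by auto
  have max: "N = M" if "N \<in> P" "M \<subseteq> N" for N using MA(2) that M(2) by auto
  have sM: "subgroup M Aut_grp" "M \<subseteq> G" using M(1) P(1) Sub by blast+
  obtain S where S: "finite S" "S \<subseteq> M" "generate Aut_grp S = M"
    using fg[OF sM M(2)] by (auto simp: fin_gen_def)
  \<comment> \<open>Every member of \<open>P\<close> in this neighbourhood contains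
    \<open>M\<close>, so it equals \<open>M\<close> by maximality, and \<open>M\<close> would be
    isolated.\<close>
  let ?U = "{L \<in> Sub G. S \<subseteq> L}"
  have "openin (chabauty G) ?U" using openin_chabauty_supersets[OF S(1)] S(2) sM(2) by blast
  moreover have "M \<in> ?U" using M(1) P(1) S(2) by blast
  moreover have "M \<in> cb_deriv (chabauty G) P" using M(1) P(2) by simp
  ultimately obtain L where L: "L \<in> P" "L \<in> ?U" "L \<noteq> M"
    unfolding in_cb_deriv_chabauty_iff[OF P(1)] by blast
  then have "M \<subseteq> L" using generate_Aut_grp_subset[of L S] S(3) Sub by blast
  then show False using max[OF L(1)] L(3) by simp
qed

theorem theorem5p1:
  fixes G :: "('a::finite) aut set"
  assumes "subgroup G Aut_grp"
    and "fin_gen G"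
    and "regular_branch G"
    and "just_infinite G"
    and "strongly_self_replicating G"
    and "well_approximated G"
    and "GN_alternative G"
    and "subgroup H (grp G)"
  shows "H \<in> perfect_kernel (chabauty G) (Sub G) \<longleftrightarrow>
           ((\<exists>y. finite (psi y H)) \<or> \<not> fin_gen H)"
proof -
  note G = assms(1)
  obtain K where K: "normal K (grp G)" "fin_index K G" "\<And>x. aut_pow K {x} \<subseteq> K"
    using assms(3) unfolding regular_branch_def by blast
  have K': "subgroup K Aut_grp" "K \<subseteq> G" "fidx K G" using K(2) fin_index_iff[OF G] by blast+
  interpret just_infinite_branch G K
  proof (rule just_infinite_branch.intro)
    show "spread x k \<in> K" if "k \<in> K" for x k
      using K(3)[of x] aut_pow_singleton[OF subgroup_Aut_grpD(1)[OF K'(1)]] that by blast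
    show "sect g x \<in> G" if "g \<in> G" for g x
      using assms(3) that by (simp add: regular_branch_def self_similar_def)
    show "level_transitive G" using assms(3) by (simp add: regular_branch_def)
    show "infinite G" using assms(4) by (simp add: just_infinite_def)
    fix N assume N: "subgroup N Aut_grp" "N \<subseteq> G"
      "\<And>g n. g \<in> G \<Longrightarrow> n \<in> N \<Longrightarrow> g \<circ> n \<circ> ainv g \<in> N" "N \<noteq> {id}"
    then have "normal N (grp G)" using normal_grp_iff[OF G] by blast
    then show "fidx N G"
      using assms(4) N(1,4) finite_rcosets_iff[OF G] unfolding just_infinite_def by blast
  qed (use assms K' in auto)
  have Sub: "L \<in> Sub G \<longleftrightarrow> subgroup L Aut_grp \<and> L \<subseteq> G" for L
    using subgroup_grp_iff[OF G] by (simp add: Sub_def)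
  have alt: "(\<exists>y. finite (psi y L)) \<or> (\<exists>Y. leaf_set Y \<and> spanning Y \<and> infra_direct G L Y)"
    if "L \<in> Sub G" "fin_gen L" for L
    using assms(7) that unfolding GN_alternative_def Sub_def by blast
  \<comment> \<open>The claimed kernel; once it is shown to have no isolated points, it lies inside
    the perfect kernel.\<close>
  define P where "P = {L \<in> Sub G. (\<exists>y. finite (psi y L)) \<or> \<not> fin_gen L}"
  have "P \<subseteq> cb_deriv (chabauty G) P"
  proof
    fix L assume LP: "L \<in> P"
    then have L: "subgroup L Aut_grp" "L \<subseteq> G" using Sub by (auto simp: P_def)
    note Ld = subgroup_Aut_grpD[OF L(1)]
    have "\<exists>M\<in>P \<inter> U. M \<noteq> L" if U: "openin (chabauty G) U" "L \<in> U" for U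
    proof -
      obtain F where F: "finite F" "F \<subseteq> G" "\<And>M. M \<in> Sub G \<Longrightarrow> M \<inter> F = L \<inter> F \<Longrightarrow> M \<in> U"
        using openin_chabauty_basis[OF U] by blast
      show ?thesis
      proof (cases "fin_gen L")
        case False
        \<comment> \<open>This subgroup agrees with \<open>L\<close> on \<open>F\<close>, and
          differs from \<open>L\<close> because it is finitely generated.\<close>
        let ?M = "generate Aut_grp (L \<inter> F)"
        have M: "subgroup ?M Aut_grp" using Ld(1) by (intro generate_Aut_grp_subgroup) auto
        have MsL: "?M \<subseteq> L" using L(1) by (rule generate_Aut_grp_subset) auto
        have incl: "L \<inter> F \<subseteq> ?M" by (auto intro: generate.incl)
        have MS: "?M \<in> Sub G" using M MsL L(2) Sub by blast
        have fgM: "fin_gen ?M" using F(1) incl by (intro fin_genI[OF M]) auto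
        \<comment> \<open>In the other case of the alternative the overgroup \<open>L\<close> would
          be finitely generated.\<close>
        have "\<exists>y. finite (psi y ?M)"
          using alt[OF MS fgM] infra_direct_overgroup_fin_gen[OF _ _ _ L MsL] False by blast
        then have "?M \<in> P" using MS by (simp add: P_def)
        moreover have "?M \<in> U" using F(3)[OF MS] MsL incl by blast
        moreover have "?M \<noteq> L" using fgM False by metis
        ultimately show ?thesis by blast
      next
        case True
        then obtain y where y: "finite (psi y L)" using LP by (auto simp: P_def)
        define Q where "Q n = {h \<circ> k | h k. h \<in> L \<and> k \<in> stab_level G n}" for n
        have eq: "L <#>\<^bsub>grp G\<^esub> stab_level G n = Q n" for n
          by (auto simp: Q_def set_mult_def mult_grp)
        have "subgroup L (grp G)" using L subgroup_grp_iff[OF G] by blast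
        then have wa: "(\<Inter>n. Q n) = L"
          unfolding eq[symmetric] using assms(6) True unfolding well_approximated_def by blast
        \<comment> \<open>Each of the finitely many elements of \<open>F\<close> outside
          \<open>L\<close> is missed by some \<open>Q n\<close>; as \<open>Q\<close> decreases, a
          single \<open>n\<close> serves them all.\<close>
        have "\<forall>f\<in>F - L. \<exists>n. f \<notin> Q n" using wa by blast
        then obtain ix where ix: "\<forall>f\<in>F - L. f \<notin> Q (ix f)" by (rule bchoice[elim_format]) blast
        define n where "n = Max (insert 0 (ix ` F))"
        have Qn: "f \<notin> Q n" if f: "f \<in> F - L" for f
        proof -
          have "ix f \<le> n" unfolding n_def using F(1) f by (intro Max_ge) auto
          then have "stab_level G n \<subseteq> stab_level G (ix f)" by (rule stab_level_mono)
          then have "Q n \<subseteq> Q (ix f)" unfolding Q_def by blast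
          then show ?thesis using ix f by blast
        qed
        obtain M z where M: "subgroup M Aut_grp" "L \<subseteq> M" "M \<noteq> L" "finite (psi z M)" "M \<subseteq> Q n"
          unfolding Q_def by (rule finite_sections_perturb[OF L y])
        have "Q n \<subseteq> G" using L(2) Gd(3) by (auto simp: Q_def stab_level_def stab_set_def)
        then have MS: "M \<in> Sub G" using M(1,5) Sub by blast
        then have "M \<in> P" using M(4) by (auto simp: P_def)
        \<comment> \<open>\<open>M\<close> lies between \<open>L\<close> and \<open>Q n\<close>,
          which meet \<open>F\<close> in the same elements.\<close>
        moreover have "M \<inter> F = L \<inter> F" using M(2,5) Qn by blast
        then have "M \<in> U" using F(3) MS by blast
        ultimately show ?thesis using M(3) by blast
      qed
    qed
    then show "L \<in> cb_deriv (chabauty G) P"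
      using in_cb_deriv_chabauty_iff[of P G L] LP by (auto simp: P_def)
  qed
  then have PK: "P \<subseteq> perfect_kernel (chabauty G) (Sub G)"
    by (intro perfect_kernel_properties(3)) (auto simp: P_def)
  have HG: "H \<in> Sub G" using assms(8) by (simp add: Sub_def)
  then have HS: "subgroup H Aut_grp" "H \<subseteq> G" using Sub by auto
  show ?thesis
  proof
    assume HK: "H \<in> perfect_kernel (chabauty G) (Sub G)"
    show "(\<exists>y. finite (psi y H)) \<or> \<not> fin_gen H"
    proof (rule ccontr)
      assume neg: "\<not> ?thesis"
      then obtain Y where Y: "leaf_set Y" "spanning Y" "infra_direct G H Y"
        using alt[OF HG] by blast
      have "H \<notin> perfect_kernel (chabauty G) (Sub G)"
        using HS perfect_kernel_properties(2,1) infra_direct_overgroup_fin_gen[OF Y]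
        by (rule noetherian_overgroups_not_in_perfect[OF G])
      then show False using HK by blast
    qed
  next
    assume "(\<exists>y. finite (psi y H)) \<or> \<not> fin_gen H"
    then show "H \<in> perfect_kernel (chabauty G) (Sub G)" using PK HG by (auto simp: P_def)
  qed
qed

end
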